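(* Let $(\zeta_i)_{i\ge 1}$ be a sequence of real random variables on a common probability space, where $\zeta_i$ has parameter $\mu_i\in\Theta\subseteq\mathbb{R}$. Fix $\mu_0\in\Theta$ and let $F_i$ be the cumulative distribution function of $\zeta_i$ when $\mu_i=\mu_0$. Put $p_i=1-F_i(\zeta_i)$ and fix $t\in[0,1]$. For $m\in\mathbb{N}$ let $I_{0,m}=\{i\in\{1,\dots,m\}:\mu_i=\mu_0\}$, $m_0=|I_{0,m}|$ (depending on $m$), $$R_m(t)=\sum_{i=1}^m 1\{p_i\le t\},\qquad V_m(t)=\sum_{i\in I_{0,m}}1\{p_i\le t\},$$ and let $\mathbf{R}=(\rho_{ij})_{1\le i,j\le m}$ be the correlation matrix of $(\zeta_1,\dots,\zeta_m)$, with $\|\mathbf{R}\|_1=\sum_{i,j=1}^m|\rho_{ij}|$. Suppose that each pair $(\zeta_i,\zeta_j)$, $i\ne j$, follows any of the following four Lancaster bivariate distributions (defined in the context) with correlation $\rho_{ij}$: 1. a Lancaster bivariate gamma distribution with shape parameter $\alpha\in(0,1]$; 2. a Lancaster bivariate Poisson distribution with parameter $\alpha>0$; 3. a Lancaster bivariate negative binomial distribution with parameter $(\beta,c)$ such that $\beta>0$ and $0<c<1$; 4. a Lancaster bivariate gamma-negative binomial distribution with parameter $(\beta,c,\alpha)$ such that $\beta>0$, $0<c<1$ and $\alpha>0$. Then: (a) There is a constant $C>0$, not depending on $i,j$, such that $$\left|\mathrm{cov}\left(1\{p_i\le t\},1\{p_j\le t\}\right)\right|\le C|\rho_{ij}|\quad\text{for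 all } i\ne j.$$ (b) If $m^{-2}\|\mathbf{R}\|_1=O(m^{-\delta})$ as $m\to\infty$ for some $\delta>0$, then almost surely $$\lim_{m\to\infty}\left|m^{-1}R_m(t)-\mathbb{E}[m^{-1}R_m(t)]\right|=0\quad\text{and}\quad \lim_{m\to\infty}\left|m^{-1}V_m(t)-\mathbb{E}[m^{-1}V_m(t)]\right|=0.$$ (c) If $m^{-2}\|\mathbf{R}\|_1=O(m^{-\delta})$ for some $\delta>0$ and in addition $\liminf_{m\to\infty}m_0m^{-1}>0$, then almost surely $$\lim_{m\to\infty}\left|m_0^{-1}V_m(t)-\mathbb{E}[m_0^{-1}V_m(t)]\right|=0.$$
   Context: Conventions. $1A$ is the indicator of $A$; $\mathbb{N}_0=\{0,1,2,\dots\}$; $(a)_0=1$ and $(a)_n=\prod_{k=0}^{n-1}(a+k)$ for $n\ge1$. In the Poisson definition below, $\binom{x}{k}=0$ for $x,k\in\mathbb{N}_0$ with $x<k$. The parameters ($\alpha$; $\alpha$; $(\beta,c)$; $(\beta,c,\alpha)$) of the four items are fixed, i.e. do not vary with the pair $(i,j)$; the same letter in different items need not denote the same value. Only the correlation $\rho_{ij}$ varies with the pair. A pair $(\zeta_i,\zeta_j)$ follows the (asymmetric) distribution of item 4 if it does so after possibly exchanging the two components. The phrase "$(X,Y)$ follows the distribution" presupposes that the displayed $h$ is a genuine probability density. The role of $\mu_i$: $\zeta_i$ belongs to a family of laws indexed by $\mu\in\Theta$, its actual law being the one with index $\mu_i$, and $F_i$ is the CDF of the law with index $\mu_0$. The $i$th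 null hypothesis is $\mu_i=\mu_0$. Laguerre polynomials: for order $\gamma>-1$ and $n\in\mathbb{N}_0$, $L_n^{(\gamma)}(x)=\sum_{k=0}^n\binom{n+\gamma}{n-k}\frac{(-x)^k}{k!}$ (generalized binomial coefficient). Lancaster bivariate gamma distribution with shape parameter $\alpha>0$ and correlation $\rho\in[0,1)$: $(X,Y)$ has Lebesgue density, for $x,y>0$, $$h(x,y)=f(x;\alpha)f(y;\alpha)\sum_{n=0}^\infty\rho^n\frac{n!\,\Gamma(\alpha)}{\Gamma(\alpha+n)}L_n^{(\alpha-1)}(x)L_n^{(\alpha-1)}(y),\qquad f(x;\alpha)=\frac{1}{\Gamma(\alpha)}x^{\alpha-1}e^{-x}.$$ Lancaster bivariate Poisson distribution with parameter $a>0$ and correlation $\rho\in[0,1]$: $(X,Y)$ has density with respect to counting measure on $\mathbb{N}_0\times\mathbb{N}_0$ $$h(x,y)=f(x;a)f(y;a)\sum_{n=0}^\infty\rho^nC_n(x;a)C_n(y;a),\qquad f(x;a)=\frac{a^xe^{-a}}{x!},$$ where $C_n(x;a)=\sqrt{\frac{a^n}{n!}}\sum_{k=0}^n(-1)^k\binom nk\binom xk\frac{k!}{a^k}$ is the Charlier polynomial. Lancaster bivariate negative binomial distribution with parameter $(\beta,c)$, $\beta>0$, $0<c<1$, and correlation $\rho\in[0,1)$: $(X,Y)$ has density with respect to counting measure on $\mathbb{N}_0\times\mathbb{N}_0$ $$h(x,y)=f(x;\beta,c)f(y;\beta,c)\sum_{n=0}^\infty\rho^nM_n^{\beta,c}(x)M_n^{\beta,c}(y),\qquad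 f(x;\beta,c)=(1-c)^\beta\frac{c^x(\beta)_x}{x!},$$ where $M_n^{\beta,c}(x)=\sqrt{\frac{c^n(\beta)_n}{n!}}\sum_{k=0}^n\frac{(-n)_k(-x)_k}{(\beta)_k\,k!}(1-c^{-1})^k$ is the normalized Meixner polynomial. Lancaster bivariate gamma-negative binomial distribution with parameter $(\beta,c,\alpha)$, $\beta>0$, $0<c<1$, $\alpha>0$, and correlation $\rho\in[0,\sqrt c]$: $(X,Y)$ takes values in $\mathbb{N}_0\times(0,\infty)$ and has density, with respect to the product of counting measure and Lebesgue measure, $$h(x,y)=f(x;\beta,c)\,g(y;\alpha)\sum_{n=0}^\infty\rho^n\sqrt{\frac{n!}{(\alpha)_n}}\,L_n^{(\alpha-1)}(y)\,M_n^{\beta,c}(x),\qquad g(y;\alpha)=\frac{1}{\Gamma(\alpha)}y^{\alpha-1}e^{-y},$$ with $f(x;\beta,c)$ and $M_n^{\beta,c}$ as in the bivariate negative binomial case. *)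

theory Defs
  imports "HOL-Probability.Probability" "HOL-Library.Landau_Symbols"
begin

definition laguerre :: "real \<Rightarrow> nat \<Rightarrow> real \<Rightarrow> real" where
  "laguerre \<gamma> n x = (\<Sum>k\<le>n. ((real n + \<gamma>) gchoose (n - k)) * (- x) ^ k / fact k)"

definition charlier :: "real \<Rightarrow> nat \<Rightarrow> nat \<Rightarrow> real" where
  "charlier a n x = sqrt (a ^ n / fact n) *
     (\<Sum>k\<le>n. (-1) ^ k * real (n choose k) * real (x choose k) * (fact k / a ^ k))"

definition meixner :: "real \<Rightarrow> real \<Rightarrow> nat \<Rightarrow> nat \<Rightarrow> real" where
  "meixner \<beta> c n x = sqrt (c ^ n * pochhammer \<beta> n / fact n) *
     (\<Sum>k\<le>n. pochhammer (- real n) k * pochhammer (- real x) k / (pochhammer \<beta> k * fact k)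
               * (1 - inverse c) ^ k)"

definition gamma_density :: "real \<Rightarrow> real \<Rightarrow> real" where
  "gamma_density \<alpha> x = (if 0 < x then x powr (\<alpha> - 1) * exp (- x) / Gamma \<alpha> else 0)"

definition poisson_mass :: "real \<Rightarrow> nat \<Rightarrow> real" where
  "poisson_mass a x = a ^ x * exp (- a) / fact x"

definition neg_binomial_mass :: "real \<Rightarrow> real \<Rightarrow> nat \<Rightarrow> real" where
  "neg_binomial_mass \<beta> c x = (1 - c) powr \<beta> * (c ^ x * pochhammer \<beta> x / fact x)"

text \<open>
  The pair \<open>(X, Y)\<close> of real random variables has law with density \<open>h\<close> with respect to the
  reference measure \<open>N\<close>. The space of \<open>N\<close> is embedded into the plane by \<open>e\<close>, so that counting
  measure can live on \<open>nat\<close> although \<open>X\<close> and \<open>Y\<close> are real-valued.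
  Nonnegativity is required separately, since \<open>ennreal\<close> truncates negative values to \<open>0\<close>;
  total mass one is inherited from the law of \<open>(X, Y)\<close> if \<open>M\<close> is a probability space.
\<close>

definition has_joint_density ::
  "'a measure \<Rightarrow> ('a \<Rightarrow> real) \<Rightarrow> ('a \<Rightarrow> real) \<Rightarrow> 'b measure \<Rightarrow> ('b \<Rightarrow> real \<times> real) \<Rightarrow> ('b \<Rightarrow> real) \<Rightarrow> bool"
where
  "has_joint_density M X Y N e h \<longleftrightarrow>
     X \<in> borel_measurable M \<and> Y \<in> borel_measurable M \<and>
     h \<in> borel_measurable N \<and> (AE z in N. 0 \<le> h z) \<and>
     distr M borel (\<lambda>\<omega>. (X \<omega>, Y \<omega>)) = distr (density N (\<lambda>z. ennreal (h z))) borel e"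

text \<open>
  The series below converge absolutely at every point for all parameters in the stated ranges.
  The gamma densities vanish off the positive half-line, hence so do the joint densities.
\<close>

definition lancaster_gamma ::
  "'a measure \<Rightarrow> real \<Rightarrow> real \<Rightarrow> ('a \<Rightarrow> real) \<Rightarrow> ('a \<Rightarrow> real) \<Rightarrow> bool"
where
  "lancaster_gamma M \<alpha> \<rho> X Y \<longleftrightarrow> 0 < \<alpha> \<and> 0 \<le> \<rho> \<and> \<rho> < 1 \<and>
     has_joint_density M X Y (lborel \<Otimes>\<^sub>M lborel) (\<lambda>z. z)
       (\<lambda>(x, y). gamma_density \<alpha> x * gamma_density \<alpha> y *
          (\<Sum>n. \<rho> ^ n * (fact n * Gamma \<alpha> / Gamma (\<alpha> + real n)) *
                laguerre (\<alpha> - 1) n x * laguerre (\<alpha> - 1) n y))"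

definition lancaster_poisson ::
  "'a measure \<Rightarrow> real \<Rightarrow> real \<Rightarrow> ('a \<Rightarrow> real) \<Rightarrow> ('a \<Rightarrow> real) \<Rightarrow> bool"
where
  "lancaster_poisson M a \<rho> X Y \<longleftrightarrow> 0 < a \<and> 0 \<le> \<rho> \<and> \<rho> \<le> 1 \<and>
     has_joint_density M X Y (count_space UNIV \<Otimes>\<^sub>M count_space UNIV) (\<lambda>(x, y). (real x, real y))
       (\<lambda>(x, y). poisson_mass a x * poisson_mass a y *
          (\<Sum>n. \<rho> ^ n * charlier a n x * charlier a n y))"

definition lancaster_neg_binomial ::
  "'a measure \<Rightarrow> real \<Rightarrow> real \<Rightarrow> real \<Rightarrow> ('a \<Rightarrow> real) \<Rightarrow> ('a \<Rightarrow> real) \<Rightarrow> bool"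
where
  "lancaster_neg_binomial M \<beta> c \<rho> X Y \<longleftrightarrow> 0 < \<beta> \<and> 0 < c \<and> c < 1 \<and> 0 \<le> \<rho> \<and> \<rho> < 1 \<and>
     has_joint_density M X Y (count_space UNIV \<Otimes>\<^sub>M count_space UNIV) (\<lambda>(x, y). (real x, real y))
       (\<lambda>(x, y). neg_binomial_mass \<beta> c x * neg_binomial_mass \<beta> c y *
          (\<Sum>n. \<rho> ^ n * meixner \<beta> c n x * meixner \<beta> c n y))"

definition lancaster_gamma_neg_binomial ::
  "'a measure \<Rightarrow> real \<Rightarrow> real \<Rightarrow> real \<Rightarrow> real \<Rightarrow> ('a \<Rightarrow> real) \<Rightarrow> ('a \<Rightarrow> real) \<Rightarrow> bool"
where
  "lancaster_gamma_neg_binomial M \<beta> c \<alpha> \<rho> X Y \<longleftrightarrow>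
     0 < \<beta> \<and> 0 < c \<and> c < 1 \<and> 0 < \<alpha> \<and> 0 \<le> \<rho> \<and> \<rho> \<le> sqrt c \<and>
     has_joint_density M X Y (count_space UNIV \<Otimes>\<^sub>M lborel) (\<lambda>(x, y). (real x, y))
       (\<lambda>(x, y). neg_binomial_mass \<beta> c x * gamma_density \<alpha> y *
          (\<Sum>n. \<rho> ^ n * sqrt (fact n / pochhammer \<alpha> n) *
                laguerre (\<alpha> - 1) n y * meixner \<beta> c n x))"

definition covariance :: "'a measure \<Rightarrow> ('a \<Rightarrow> real) \<Rightarrow> ('a \<Rightarrow> real) \<Rightarrow> real" where
  "covariance M X Y = (\<integral>\<omega>. (X \<omega> - (\<integral>\<omega>. X \<omega> \<partial>M)) * (Y \<omega> - (\<integral>\<omega>. Y \<omega> \<partial>M)) \<partial>M)"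

definition correlation :: "'a measure \<Rightarrow> ('a \<Rightarrow> real) \<Rightarrow> ('a \<Rightarrow> real) \<Rightarrow> real" where
  "correlation M X Y = covariance M X Y / (sqrt (covariance M X X) * sqrt (covariance M Y Y))"

definition entrywise_norm1 :: "(nat \<Rightarrow> nat \<Rightarrow> real) \<Rightarrow> nat \<Rightarrow> real" where
  "entrywise_norm1 r m = (\<Sum>i\<in>{1..m}. \<Sum>j\<in>{1..m}. \<bar>r i j\<bar>)"

definition true_nulls :: "(nat \<Rightarrow> real) \<Rightarrow> real \<Rightarrow> nat \<Rightarrow> nat set" where
  "true_nulls \<mu> \<mu>0 m = {i \<in> {1..m}. \<mu> i = \<mu>0}"

text \<open>\<open>L i \<theta>\<close> is the law of the \<open>i\<close>-th statistic under parameter value \<open>\<theta>\<close>.\<close>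

definition p_value ::
  "(nat \<Rightarrow> real \<Rightarrow> real measure) \<Rightarrow> real \<Rightarrow> (nat \<Rightarrow> 'a \<Rightarrow> real) \<Rightarrow> nat \<Rightarrow> 'a \<Rightarrow> real"
where
  "p_value L \<mu>0 \<zeta> i \<omega> = 1 - cdf (L i \<mu>0) (\<zeta> i \<omega>)"

definition rejected :: "(nat \<Rightarrow> 'a \<Rightarrow> real) \<Rightarrow> real \<Rightarrow> nat \<Rightarrow> 'a \<Rightarrow> real" where
  "rejected p t i \<omega> = of_bool (p i \<omega> \<le> t)"

definition num_rejections :: "(nat \<Rightarrow> 'a \<Rightarrow> real) \<Rightarrow> real \<Rightarrow> nat \<Rightarrow> 'a \<Rightarrow> real" where
  "num_rejections p t m \<omega> = (\<Sum>i\<in>{1..m}. rejected p t i \<omega>)"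

definition num_false_rejections ::
  "(nat \<Rightarrow> real) \<Rightarrow> real \<Rightarrow> (nat \<Rightarrow> 'a \<Rightarrow> real) \<Rightarrow> real \<Rightarrow> nat \<Rightarrow> 'a \<Rightarrow> real"
where
  "num_false_rejections \<mu> \<mu>0 p t m \<omega> = (\<Sum>i\<in>true_nulls \<mu> \<mu>0 m. rejected p t i \<omega>)"

end

theory Submission
  imports Defs
begin

text \<open>
  In each of the three families the normalised polynomial has the form
  \<open>\<phi>\<^sub>n = \<kappa>\<^sub>n \<Sum>\<^sub>k (-1)\<^sup>k (n choose k) u\<^sub>k\<close> with \<open>u\<^sub>k \<ge> 0\<close> of mean 1 under the weight (moments of the
  gamma law, factorial moments of the discrete laws). Hence \<open>\<phi>\<^sub>n\<close> has mean 0 for \<open>n \<ge> 1\<close> and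
  \<open>E \<bar>\<phi>\<^sub>n\<bar> \<le> \<bar>\<kappa>\<^sub>n\<bar> 2\<^sup>n \<le> r\<^sup>n\<close>. This crude bound replaces orthonormality: for small \<open>\<rho>\<close> the Lancaster
  series may be integrated term by term, its term of index 0 is the product of the marginal
  probabilities, and the rest is a geometric tail of order \<open>\<rho>\<close>; for \<open>\<rho>\<close> bounded away from 0 the
  covariance of two indicators is at most \<open>1 = O(\<rho>)\<close> anyway.

  The almost sure convergence follows since the averages then have variance \<open>O(m\<^sup>-\<^sup>d)\<close> for some
  \<open>d > 0\<close>: this is summable along the subsequence \<open>m = k\<^sup>q\<close> for large \<open>q\<close>, and between consecutive
  powers bounded summands move the averages by a vanishing amount.
\<close>

section \<open>Term-by-term integration of bilinear densities\<close>

text \<open>The substitute for an orthonormal system: zero mean for positive index and a geometric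
  L1 bound of rate \<open>r\<close>. Weight and polynomial enter only through their product, so the
  reference measure remains Lebesgue or counting measure.\<close>

definition centred_sequence ::
  "'b measure \<Rightarrow> ('b \<Rightarrow> real) \<Rightarrow> (nat \<Rightarrow> 'b \<Rightarrow> real) \<Rightarrow> real \<Rightarrow> bool"
where
  "centred_sequence N f \<phi> r \<longleftrightarrow> (\<forall>n. integrable N (\<lambda>x. f x * \<phi> n x)
     \<and> (\<integral>x. f x * \<phi> n x \<partial>N) = of_bool (n = 0) \<and> (\<integral>x. \<bar>f x * \<phi> n x\<bar> \<partial>N) \<le> r ^ n)"

text \<open>By Tonelli the sum of the absolute values has finite integral, so it is finite almost
  everywhere. This serves both the exchange of series and integral and, in place of Borel-Cantelli,
  the almost sure convergence.\<close>

lemma AE_summable_of_summable_integral: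
  fixes F :: "nat \<Rightarrow> 'b \<Rightarrow> real"
  assumes int: "\<And>n. integrable N (F n)" and sm: "summable (\<lambda>n. \<integral>x. \<bar>F n x\<bar> \<partial>N)"
  shows "AE x in N. summable (\<lambda>n. \<bar>F n x\<bar>)"
proof -
  have [measurable]: "F n \<in> borel_measurable N" for n
    using int by auto
  have "(\<integral>\<^sup>+x. (\<Sum>n. ennreal \<bar>F n x\<bar>) \<partial>N) = (\<Sum>n. \<integral>\<^sup>+x. ennreal \<bar>F n x\<bar> \<partial>N)"
    by (rule nn_integral_suminf) auto
  also have "\<dots> = (\<Sum>n. ennreal (\<integral>x. \<bar>F n x\<bar> \<partial>N))"
    by (intro suminf_cong nn_integral_eq_integral integrable_abs int) auto
  also have "\<dots> \<noteq> \<infinity>"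
    using sm by (subst suminf_ennreal_eq[OF _ summable_sums[OF sm]]) auto
  finally have "AE x in N. (\<Sum>n. ennreal \<bar>F n x\<bar>) \<noteq> \<infinity>"
    by (intro nn_integral_noteq_infinite) auto
  thus ?thesis
    by eventually_elim (auto intro: summable_suminf_not_top)
qed

lemma (in pair_sigma_finite)
  fixes u :: "'a \<Rightarrow> real" and v :: "'b \<Rightarrow> real"
  assumes u: "integrable M1 u" and v: "integrable M2 v"
  shows integrable_product: "integrable (M1 \<Otimes>\<^sub>M M2) (\<lambda>(x, y). u x * v y)"
    and integral_product: "(\<integral>z. (case z of (x, y) \<Rightarrow> u x * v y) \<partial>(M1 \<Otimes>\<^sub>M M2)) = (\<integral>x. u x \<partial>M1) * (\<integral>y. v y \<partial>M2)"
proof -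
  have [measurable]: "u \<in> borel_measurable M1" "v \<in> borel_measurable M2"
    using u v by auto
  show *: "integrable (M1 \<Otimes>\<^sub>M M2) (\<lambda>(x, y). u x * v y)"
    using u v by (intro Fubini_integrable) (auto simp: abs_mult)
  show "(\<integral>z. (case z of (x, y) \<Rightarrow> u x * v y) \<partial>(M1 \<Otimes>\<^sub>M M2)) = (\<integral>x. u x \<partial>M1) * (\<integral>y. v y \<partial>M2)"
    using integral_fst'[OF *] by simp
qed

lemma restricted_integrable:
  fixes u e :: "'b \<Rightarrow> real"
  assumes u: "integrable N u" and e: "e \<in> borel_measurable N" and S: "S \<in> sets borel"
  shows "integrable N (\<lambda>x. u x * indicator S (e x))"
    and "(\<integral>x. \<bar>u x * indicator S (e x)\<bar> \<partial>N) \<le> (\<integral>x. \<bar>u x\<bar> \<partial>N)"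
proof -
  have [measurable]: "u \<in> borel_measurable N"
    using u by auto
  note [measurable] = e S
  show *: "integrable N (\<lambda>x. u x * indicator S (e x))"
    by (rule Bochner_Integration.integrable_bound[OF u]) (auto simp: indicator_def)
  show "(\<integral>x. \<bar>u x * indicator S (e x)\<bar> \<partial>N) \<le> (\<integral>x. \<bar>u x\<bar> \<partial>N)"
    using u * by (intro integral_mono) (auto simp: indicator_def)
qed

text \<open>Cut down to \<open>S\<close> and \<open>T\<close>, the density becomes a series of
  product functions with L1 norms at most \<open>(\<rho> * (r * s)) ^ n\<close>. These norms are
  summable, so the series may be integrated termwise, and Fubini factors each term.\<close>

lemma joint_prob_sums:
  fixes f :: "'b \<Rightarrow> real" and g :: "'c \<Rightarrow> real"
  assumes N: "sigma_finite_measure N1" "sigma_finite_measure N2"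
    and \<phi>: "centred_sequence N1 f \<phi> r" and \<psi>: "centred_sequence N2 g \<psi> s"
    and e: "e1 \<in> borel_measurable N1" "e2 \<in> borel_measurable N2"
    and \<rho>: "0 \<le> \<rho>" "\<rho> * (r * s) < 1" and rs: "0 \<le> r" "0 \<le> s"
    and dens: "has_joint_density M X Y (N1 \<Otimes>\<^sub>M N2) (\<lambda>(x, y). (e1 x, e2 y))
      (\<lambda>(x, y). f x * g y * (\<Sum>n. \<rho> ^ n * (\<phi> n x * \<psi> n y)))"
    and S: "S \<in> sets borel" and T: "T \<in> sets borel"
  shows "(\<lambda>n. \<rho> ^ n * ((\<integral>x. f x * \<phi> n x * indicator S (e1 x) \<partial>N1) *
                         (\<integral>y. g y * \<psi> n y * indicator T (e2 y) \<partial>N2)))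
      sums measure M {\<omega> \<in> space M. X \<omega> \<in> S \<and> Y \<omega> \<in> T}"
proof -
  interpret N1: sigma_finite_measure N1 by fact
  interpret N2: sigma_finite_measure N2 by fact
  interpret P: pair_sigma_finite N1 N2 ..
  let ?D = "N1 \<Otimes>\<^sub>M N2" and ?e = "\<lambda>(x, y). (e1 x, e2 y)"
  define h where "h = (\<lambda>(x, y). f x * g y * (\<Sum>n. \<rho> ^ n * (\<phi> n x * \<psi> n y)))"
  define u where "u n x = f x * \<phi> n x * indicator S (e1 x)" for n x
  define v where "v n y = g y * \<psi> n y * indicator T (e2 y)" for n y
  define F where "F n = (\<lambda>(x, y). \<rho> ^ n * (u n x * v n y))" for n
  note [measurable] = e S T
  have h: "h \<in> borel_measurable ?D" "AE z in ?D. 0 \<le> h z"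
    and XY[measurable]: "X \<in> borel_measurable M" "Y \<in> borel_measurable M"
    and law: "distr M borel (\<lambda>\<omega>. (X \<omega>, Y \<omega>)) = distr (density ?D (\<lambda>z. ennreal (h z))) borel ?e"
    using dens unfolding has_joint_density_def h_def by auto
  note [measurable] = h(1)
  have ui: "integrable N1 (u n)" "(\<integral>x. \<bar>u n x\<bar> \<partial>N1) \<le> r ^ n" for n
    using \<phi> restricted_integrable[OF _ e(1) S, of "\<lambda>x. f x * \<phi> n x"]
    unfolding u_def centred_sequence_def by (blast intro: order_trans)+
  have vi: "integrable N2 (v n)" "(\<integral>y. \<bar>v n y\<bar> \<partial>N2) \<le> s ^ n" for n
    using \<psi> restricted_integrable[OF _ e(2) T, of "\<lambda>y. g y * \<psi> n y"]
    unfolding v_def centred_sequence_def by (blast intro: order_trans)+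
  have Fi: "integrable ?D (F n)" for n
    using P.integrable_product[OF ui(1)[of n] vi(1)[of n]]
    unfolding F_def by (simp add: case_prod_beta')
  have FI: "integral\<^sup>L ?D (F n) = \<rho> ^ n * ((\<integral>x. u n x \<partial>N1) * (\<integral>y. v n y \<partial>N2))" for n
    using P.integral_product[OF ui(1)[of n] vi(1)[of n]]
    unfolding F_def by (simp add: case_prod_beta')
  have FA: "(\<integral>z. \<bar>F n z\<bar> \<partial>?D) \<le> (\<rho> * (r * s)) ^ n" for n
  proof -
    have "(\<integral>z. \<bar>F n z\<bar> \<partial>?D) = \<rho> ^ n * ((\<integral>x. \<bar>u n x\<bar> \<partial>N1) * (\<integral>y. \<bar>v n y\<bar> \<partial>N2))"
      using P.integral_product[OF integrable_abs[OF ui(1)[of n]] integrable_abs[OF vi(1)[of n]]] \<rho>(1)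
      unfolding F_def by (simp add: case_prod_beta' abs_mult)
    also have "\<dots> \<le> \<rho> ^ n * (r ^ n * s ^ n)"
      using ui(2) vi(2) \<rho> rs by (intro mult_left_mono mult_mono) auto
    finally show ?thesis by (simp add: power_mult_distrib)
  qed
  have sm: "summable (\<lambda>n. \<integral>z. \<bar>F n z\<bar> \<partial>?D)"
    by (rule summable_comparison_test'[OF summable_geometric[of "\<rho> * (r * s)"]])
       (use FA \<rho> rs in auto)
  have ae: "AE z in ?D. summable (\<lambda>n. \<bar>F n z\<bar>)"
    by (intro AE_summable_of_summable_integral Fi sm)
  have Fh: "AE z in ?D. (\<Sum>n. F n z) = h z * indicator (S \<times> T) (?e z)"
    using ae
  proof eventually_elim
    case (elim z)
    obtain x y where z: "z = (x, y)" by force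
    show ?case
    \<comment> \<open>Where the prefactor vanishes, both sides are 0 whether or not the Lancaster
      series converges. Elsewhere it can be cancelled, so summability of \<open>F\<close> passes to
      that series and the factor can be pulled out.\<close>
    proof (cases "f x * g y * indicator S (e1 x) * indicator T (e2 y) = 0")
      case True
      hence "F n z = 0" for n by (auto simp: F_def u_def v_def z)
      with True show ?thesis by (auto simp: z h_def indicator_def split: if_splits)
    next
      case False
      let ?c = "f x * g y"
      have c: "?c \<noteq> 0" "e1 x \<in> S" "e2 y \<in> T" using False by (auto simp: indicator_def split: if_splits)
      hence F: "F n z = ?c * (\<rho> ^ n * (\<phi> n x * \<psi> n y))" for n
        by (simp add: F_def u_def v_def z)
      have "summable (\<lambda>n. F n z)"
        using elim by (rule summable_rabs_cancel)
      hence "summable (\<lambda>n. \<rho> ^ n * (\<phi> n x * \<psi> n y))"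
        unfolding F using c by (subst (asm) summable_cmult_iff) auto
      thus ?thesis using c unfolding F by (simp add: suminf_mult z h_def)
    qed
  qed
  have "measure M {\<omega> \<in> space M. X \<omega> \<in> S \<and> Y \<omega> \<in> T}
      = measure (distr M borel (\<lambda>\<omega>. (X \<omega>, Y \<omega>))) (S \<times> T)"
    by (subst measure_distr) (auto intro!: arg_cong[of _ _ "measure M"] borel_Times)
  also have "\<dots> = measure (density ?D (\<lambda>z. ennreal (h z))) (?e -` (S \<times> T) \<inter> space ?D)"
    unfolding law by (subst measure_distr) (auto intro!: borel_Times)
  also have "\<dots> = enn2real (\<integral>\<^sup>+z. ennreal (h z) * indicator (?e -` (S \<times> T) \<inter> space ?D) z \<partial>?D)"
    unfolding measure_def
    by (subst emeasure_density) (auto intro!: measurable_sets[of _ _ borel] borel_Times)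
  also have "(\<integral>\<^sup>+z. ennreal (h z) * indicator (?e -` (S \<times> T) \<inter> space ?D) z \<partial>?D)
      = (\<integral>\<^sup>+z. ennreal (\<Sum>n. F n z) \<partial>?D)"
    using Fh h(2) by (intro nn_integral_cong_AE) (auto elim!: eventually_elim2 simp: indicator_def)
  \<comment> \<open>Since \<open>h\<close> is nonnegative almost everywhere, so is the sum of the
    \<open>F n\<close>, and the extended nonnegative integral agrees with the Bochner
    integral.\<close>
  also have "enn2real \<dots> = (\<integral>z. (\<Sum>n. F n z) \<partial>?D)"
  proof (rule integral_eq_nn_integral[symmetric])
    show "AE z in ?D. 0 \<le> (\<Sum>n. F n z)"
      using Fh h(2) by eventually_elim simp
    show "(\<lambda>z. \<Sum>n. F n z) \<in> borel_measurable ?D"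
      using Fi by (intro borel_measurable_suminf) auto
  qed
  finally have eq: "measure M {\<omega> \<in> space M. X \<omega> \<in> S \<and> Y \<omega> \<in> T} = (\<integral>z. (\<Sum>n. F n z) \<partial>?D)" .
  have "(\<lambda>n. integral\<^sup>L ?D (F n)) sums (\<integral>z. (\<Sum>n. F n z) \<partial>?D)"
    using Fi ae sm by (intro sums_integral) auto
  thus ?thesis unfolding eq FI u_def v_def .
qed

section \<open>Covariances of indicators under a bilinear density\<close>

lemma covariance_indicator:
  assumes "prob_space M" and "A \<in> sets M" "B \<in> sets M"
  shows "covariance M (indicator A) (indicator B) = measure M (A \<inter> B) - measure M A * measure M B"
proof -
  interpret prob_space M by fact
  have "covariance M (indicator A) (indicator B)
      = (\<integral>\<omega>. indicator (A \<inter> B) \<omega> - measure M B * indicator A \<omega> - measure M A * indicator B \<omega>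
            + measure M A * measure M B \<partial>M)"
    unfolding covariance_def using assms
    by (intro Bochner_Integration.integral_cong) (auto simp: algebra_simps indicator_def)
  also have "\<dots> = measure M (A \<inter> B) - measure M A * measure M B"
    using assms by (simp add: prob_space emeasure_eq_measure)
  finally show ?thesis .
qed

lemma abs_covariance_indicator_le_1:
  assumes "prob_space M" and "A \<in> sets M" "B \<in> sets M"
  shows "\<bar>covariance M (indicator A) (indicator B)\<bar> \<le> 1"
proof -
  interpret prob_space M by fact
  have "0 \<le> prob A * prob B" "prob A * prob B \<le> 1"
    by (auto intro: mult_le_one)
  moreover have "0 \<le> prob (A \<inter> B)" "prob (A \<inter> B) \<le> 1"
    by auto
  ultimately show ?thesis
    unfolding covariance_indicator[OF assms] by linarith
qed

lemma covariance_cong: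
  assumes "\<And>\<omega>. \<omega> \<in> space M \<Longrightarrow> X \<omega> = X' \<omega>" "\<And>\<omega>. \<omega> \<in> space M \<Longrightarrow> Y \<omega> = Y' \<omega>"
  shows "covariance M X Y = covariance M X' Y'"
proof -
  have "(\<integral>\<omega>. X \<omega> \<partial>M) = (\<integral>\<omega>. X' \<omega> \<partial>M)" "(\<integral>\<omega>. Y \<omega> \<partial>M) = (\<integral>\<omega>. Y' \<omega> \<partial>M)"
    by (intro Bochner_Integration.integral_cong refl assms; assumption)+
  thus ?thesis
    unfolding covariance_def by (intro Bochner_Integration.integral_cong refl) (simp add: assms)
qed

lemma covariance_commute: "covariance M X Y = covariance M Y X"
  by (simp add: covariance_def mult.commute)

text \<open>In the expansion of the joint probability the term of index 0 is the product of the
  marginals, so the covariance is a tail bounded by a geometric series in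
  \<open>\<rho> * (r * s)\<close>. Separate spaces, weights and rates for the two components
  accommodate the mixed gamma-negative binomial pair.\<close>

lemma abs_covariance_le_of_joint_density:
  fixes f :: "'b \<Rightarrow> real" and g :: "'c \<Rightarrow> real"
  assumes M: "prob_space M"
    and N: "sigma_finite_measure N1" "sigma_finite_measure N2"
    and \<phi>: "centred_sequence N1 f \<phi> r" and \<psi>: "centred_sequence N2 g \<psi> s"
    and e: "e1 \<in> borel_measurable N1" "e2 \<in> borel_measurable N2"
    and \<rho>: "0 \<le> \<rho>" and rs: "0 \<le> r" "0 \<le> s"
    and dens: "has_joint_density M X Y (N1 \<Otimes>\<^sub>M N2) (\<lambda>(x, y). (e1 x, e2 y))
      (\<lambda>(x, y). f x * g y * (\<Sum>n. \<rho> ^ n * (\<phi> n x * \<psi> n y)))"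
    and S: "S \<in> sets borel" and T: "T \<in> sets borel"
  shows "\<bar>covariance M (\<lambda>\<omega>. of_bool (X \<omega> \<in> S)) (\<lambda>\<omega>. of_bool (Y \<omega> \<in> T))\<bar> \<le> 2 * (r * s) * \<rho>"
proof -
  interpret prob_space M by fact
  have XY[measurable]: "X \<in> borel_measurable M" "Y \<in> borel_measurable M"
    using dens unfolding has_joint_density_def by auto
  note [measurable] = S T e
  let ?A = "{\<omega> \<in> space M. X \<omega> \<in> S}" and ?B = "{\<omega> \<in> space M. Y \<omega> \<in> T}"
  have AB[simp]: "?A \<in> events" "?B \<in> events" by measurable
  have cov: "covariance M (\<lambda>\<omega>. of_bool (X \<omega> \<in> S)) (\<lambda>\<omega>. of_bool (Y \<omega> \<in> T))
      = covariance M (indicator ?A) (indicator ?B)"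
    by (rule covariance_cong) (simp_all add: indicator_def)
  define q where "q = \<rho> * (r * s)"
  have q0: "0 \<le> q" using \<rho> rs by (simp add: q_def)
  show ?thesis
  \<comment> \<open>The threshold makes \<open>2 * q\<close> a bound in both cases: above 1/2 it
    exceeds the trivial bound 1, and up to 1/2 the tail sum \<open>q / (1 - q)\<close> is at most
    \<open>2 * q\<close>.\<close>
  proof (cases "q \<le> 1 / 2")
    case False
    hence "1 \<le> 2 * (r * s) * \<rho>" by (simp add: q_def mult_ac)
    thus ?thesis
      unfolding cov using abs_covariance_indicator_le_1[OF M AB] by linarith
  next
    case True
    define a where "a n = (\<integral>x. f x * \<phi> n x * indicator S (e1 x) \<partial>N1)" for n
    define b where "b n = (\<integral>y. g y * \<psi> n y * indicator T (e2 y) \<partial>N2)" for n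
    have q1: "\<rho> * (r * s) < 1" using True by (simp add: q_def)
    note sums = joint_prob_sums[OF N \<phi> \<psi> e \<rho> q1 rs dens]
    have \<phi>0: "(\<integral>x. f x * \<phi> n x * indicator UNIV (e1 x) \<partial>N1) = of_bool (n = 0)" for n
      using \<phi> by (simp add: centred_sequence_def)
    have \<psi>0: "(\<integral>x. g x * \<psi> n x * indicator UNIV (e2 x) \<partial>N2) = of_bool (n = 0)" for n
      using \<psi> by (simp add: centred_sequence_def)
    \<comment> \<open>Taking one of the two sets to be \<open>UNIV\<close> identifies the marginals with the terms of index 0.\<close>
    have zero: "(\<lambda>n. \<rho> ^ n * (c n * of_bool (n = 0))) sums c 0" for c :: "nat \<Rightarrow> real"
      using sums_single[of 0 c] by (rule sums_cong[THEN iffD1, rotated]) simp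
    have a0: "prob ?A = a 0"
      using sums[OF S, of UNIV] zero[of a] unfolding a_def[symmetric] \<psi>0
      by (auto dest: sums_unique2)
    have b0: "prob ?B = b 0"
      using sums[OF _ T, of UNIV] zero[of b] unfolding b_def[symmetric] \<phi>0
      by (auto simp: mult.commute dest: sums_unique2)
    have eq: "{\<omega> \<in> space M. X \<omega> \<in> S \<and> Y \<omega> \<in> T} = ?A \<inter> ?B" by auto
    have "(\<lambda>n. \<rho> ^ n * (a n * b n)) sums prob (?A \<inter> ?B)"
      using sums[OF S T] unfolding a_def b_def eq .
    \<comment> \<open>As \<open>a 0\<close> and \<open>b 0\<close> are the marginal probabilities,
      dropping the first term leaves exactly the covariance.\<close>
    hence tail: "(\<lambda>n. \<rho> ^ Suc n * (a (Suc n) * b (Suc n))) sums (prob (?A \<inter> ?B) - prob ?A * prob ?B)"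
      using sums_Suc_iff[of "\<lambda>n. \<rho> ^ n * (a n * b n)"] by (simp add: a0 b0)
    have ab: "\<bar>a n\<bar> \<le> r ^ n" "\<bar>b n\<bar> \<le> s ^ n" for n
    proof -
      have "\<bar>a n\<bar> \<le> (\<integral>x. \<bar>f x * \<phi> n x * indicator S (e1 x)\<bar> \<partial>N1)"
        unfolding a_def by (rule integral_abs_bound)
      also have "\<dots> \<le> r ^ n"
        using \<phi> restricted_integrable(2)[OF _ e(1) S, of "\<lambda>x. f x * \<phi> n x"]
        unfolding centred_sequence_def by (blast intro: order_trans)
      finally show "\<bar>a n\<bar> \<le> r ^ n" .
      have "\<bar>b n\<bar> \<le> (\<integral>x. \<bar>g x * \<psi> n x * indicator T (e2 x)\<bar> \<partial>N2)"
        unfolding b_def by (rule integral_abs_bound)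
      also have "\<dots> \<le> s ^ n"
        using \<psi> restricted_integrable(2)[OF _ e(2) T, of "\<lambda>x. g x * \<psi> n x"]
        unfolding centred_sequence_def by (blast intro: order_trans)
      finally show "\<bar>b n\<bar> \<le> s ^ n" .
    qed
    have term_le: "\<bar>\<rho> ^ n * (a n * b n)\<bar> \<le> q ^ n" for n
    proof -
      have "\<bar>\<rho> ^ n * (a n * b n)\<bar> = \<rho> ^ n * (\<bar>a n\<bar> * \<bar>b n\<bar>)"
        using \<rho> by (simp add: abs_mult)
      also have "\<dots> \<le> \<rho> ^ n * (r ^ n * s ^ n)"
        using ab \<rho> rs by (intro mult_left_mono mult_mono) auto
      finally show ?thesis by (simp add: q_def power_mult_distrib)
    qed
    have geo: "(\<lambda>n. q ^ Suc n) sums (q * (1 / (1 - q)))"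
      using sums_mult[OF geometric_sums[of q], of q] q0 True by simp
    have "\<bar>prob (?A \<inter> ?B) - prob ?A * prob ?B\<bar> \<le> q * (1 / (1 - q))"
      using term_le by (intro norm_sums_le[OF tail geo, unfolded real_norm_def])
    also have "\<dots> \<le> q * 2"
      using q0 True by (intro mult_left_mono) (auto simp: field_simps)
    finally show ?thesis
      unfolding cov covariance_indicator[OF M AB] by (simp add: q_def mult_ac)
  qed
qed

section \<open>Laguerre, Charlier and Meixner polynomials\<close>

text \<open>Each \<open>u k\<close> has mean 1, so the mean of \<open>\<phi> n\<close> is
  \<open>\<kappa> n\<close> times the alternating row sum \<open>(1 - 1) ^ n\<close>, and its
  absolute mean is at most \<open>\<bar>\<kappa> n\<bar>\<close> times \<open>(1 + 1) ^ n\<close>;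
  hence the 2 in the rate. Positivity is asked of the product with \<open>f\<close> because the
  powers used for Laguerre polynomials change sign on the negative half-line, where the gamma weight
  is 0.\<close>

lemma centred_sequenceI:
  fixes u :: "nat \<Rightarrow> 'b \<Rightarrow> real"
  assumes u: "\<And>k. has_bochner_integral N (\<lambda>x. f x * u k x) 1"
    and pos: "\<And>k x. 0 \<le> f x * u k x"
    and \<phi>: "\<And>n x. f x * \<phi> n x = \<kappa> n * (\<Sum>k\<le>n. (-1) ^ k * real (n choose k) * (f x * u k x))"
    and \<kappa>: "\<kappa> 0 = 1" "\<And>n. \<bar>\<kappa> n\<bar> \<le> s ^ n"
  shows "centred_sequence N f \<phi> (2 * s)"
  unfolding centred_sequence_def
proof (intro allI conjI)
  fix n
  have [simp]: "integrable N (\<lambda>x. f x * u k x)" "(\<integral>x. f x * u k x \<partial>N) = 1" for k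
    using u by (simp_all add: has_bochner_integral_iff)
  show int: "integrable N (\<lambda>x. f x * \<phi> n x)"
    unfolding \<phi> by simp
  have "(\<integral>x. f x * \<phi> n x \<partial>N) = \<kappa> n * (\<Sum>k\<le>n. (-1) ^ k * real (n choose k))"
    unfolding \<phi> by simp
  thus "(\<integral>x. f x * \<phi> n x \<partial>N) = of_bool (n = 0)"
    using choose_alternating_sum[of n, where 'a = real] \<kappa>(1) by (cases "n = 0") auto
  have "(\<integral>x. \<bar>f x * \<phi> n x\<bar> \<partial>N) \<le> (\<integral>x. \<bar>\<kappa> n\<bar> * (\<Sum>k\<le>n. real (n choose k) * (f x * u k x)) \<partial>N)"
  proof (rule integral_mono)
    fix x
    have "\<bar>f x * \<phi> n x\<bar> \<le> \<bar>\<kappa> n\<bar> * (\<Sum>k\<le>n. \<bar>(-1) ^ k * real (n choose k) * (f x * u k x)\<bar>)"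
      unfolding \<phi> abs_mult[of "\<kappa> n"] by (intro mult_left_mono sum_abs) auto
    also have "\<dots> = \<bar>\<kappa> n\<bar> * (\<Sum>k\<le>n. real (n choose k) * (f x * u k x))"
    proof -
      have "\<bar>(-1) ^ k * real (n choose k) * y\<bar> = real (n choose k) * y" if "0 \<le> y" for y k
        using that by (simp add: abs_mult)
      thus ?thesis using pos by simp
    qed
    finally show "\<bar>f x * \<phi> n x\<bar> \<le> \<dots>" .
  qed (use int in auto)
  also have "\<dots> = \<bar>\<kappa> n\<bar> * (\<Sum>k\<le>n. real (n choose k))"
    by simp
  also have "(\<Sum>k\<le>n. real (n choose k)) = 2 ^ n"
    using choose_row_sum[of n] by (metis of_nat_numeral of_nat_power of_nat_sum)
  also have "\<bar>\<kappa> n\<bar> * 2 ^ n \<le> s ^ n * 2 ^ n"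
    by (intro mult_right_mono \<kappa>) auto
  finally show "(\<integral>x. \<bar>f x * \<phi> n x\<bar> \<partial>N) \<le> (2 * s) ^ n"
    by (simp add: power_mult_distrib mult.commute)
qed

section \<open>Charlier polynomials under the Poisson weight\<close>

lemma has_bochner_integral_count_space_nat:
  fixes f :: "nat \<Rightarrow> real"
  assumes "f sums a" "\<And>x. 0 \<le> f x"
  shows "has_bochner_integral (count_space UNIV) f a"
  using assms integral_count_space_nat[of f]
  by (auto simp: has_bochner_integral_iff integrable_count_space_nat_iff sums_iff)

lemma choose_mult_fact: "x \<ge> k \<Longrightarrow> real (x choose k) * fact k = fact x / fact (x - k)"
  by (simp add: binomial_fact)

text \<open>The functions \<open>u k\<close> are the falling factorials of \<open>x\<close> divided
  by \<open>a ^ k\<close>, which is the k-th factorial moment of the Poisson law.\<close>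

lemma centred_sequence_charlier:
  assumes a: "0 < a"
  shows "centred_sequence (count_space UNIV) (poisson_mass a) (charlier a) (2 * max 1 a)"
proof (rule centred_sequenceI[where u = "\<lambda>k x. real (x choose k) * (fact k / a ^ k)"])
  fix k
  show "has_bochner_integral (count_space UNIV)
          (\<lambda>x. poisson_mass a x * (real (x choose k) * (fact k / a ^ k))) 1"
  proof (rule has_bochner_integral_count_space_nat)
    \<comment> \<open>The terms with \<open>x < k\<close> vanish; after a shift by \<open>k\<close>
      the rest is \<open>exp (- a)\<close> times the exponential series.\<close>
    have eq: "poisson_mass a (x + k) * (real ((x + k) choose k) * (fact k / a ^ k)) = exp (- a) * (a ^ x /\<^sub>R fact x)" for x
      using a choose_mult_fact[of k "x + k"]
      by (simp add: poisson_mass_def power_add field_simps)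
    have "(\<lambda>x. exp (- a) * (a ^ x /\<^sub>R fact x)) sums (exp (- a) * exp a)"
      by (intro sums_mult exp_converges)
    thus "(\<lambda>x. poisson_mass a x * (real (x choose k) * (fact k / a ^ k))) sums 1"
      unfolding eq[symmetric] by (subst (asm) sums_iff_shift) (simp add: exp_minus binomial_eq_0)
  qed (use a in \<open>simp add: poisson_mass_def\<close>)
next
  fix n
  \<comment> \<open>The base \<open>max 1 a\<close> is at least 1, so the exponent may be doubled;
    the square root then restores exactly \<open>max 1 a ^ n\<close>.\<close>
  have "a ^ n / fact n \<le> max 1 a ^ n / 1"
    using a by (intro frac_le power_mono) auto
  also have "\<dots> \<le> max 1 a ^ (n + n)"
    by (simp, intro power_increasing) auto
  finally have "sqrt (a ^ n / fact n) \<le> sqrt ((max 1 a ^ n)\<^sup>2)"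
    by (simp add: power_mult[symmetric] mult_2_right)
  thus "\<bar>sqrt (a ^ n / fact n)\<bar> \<le> max 1 a ^ n"
    using a by simp
qed (use a in \<open>auto simp: poisson_mass_def charlier_def sum_distrib_left mult_ac\<close>)

section \<open>Meixner polynomials under the negative binomial weight\<close>

text \<open>Consecutive quotients have ratio \<open>(a + n) / (1 + n)\<close>, a weighted mean of
  \<open>a\<close> and 1, hence at most their maximum. The bound controls the constants of both the
  Meixner and the Laguerre polynomials.\<close>

lemma pochhammer_over_fact_le:
  assumes "0 < (a::real)" shows "pochhammer a n / fact n \<le> max 1 a ^ n"
proof (induction n)
  case (Suc n)
  have "pochhammer a (Suc n) / fact (Suc n) = (pochhammer a n / fact n) * ((a + real n) / (1 + real n))"
    by (simp add: pochhammer_Suc field_simps)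
  also have "(a + real n) / (1 + real n) \<le> max 1 a"
    using assms mult_right_mono[of 1 "max 1 a" "real n"]
    by (simp add: divide_le_eq algebra_simps)
  hence "(pochhammer a n / fact n) * ((a + real n) / (1 + real n)) \<le> max 1 a ^ n * max 1 a"
    using Suc.IH assms by (intro mult_mono) (auto simp: pochhammer_nonneg)
  finally show ?case by (simp add: mult.commute)
qed auto

lemma sqrt_pochhammer_over_fact_le:
  assumes "0 < (a::real)" shows "sqrt (pochhammer a n / fact n) \<le> max 1 a ^ n"
proof -
  have "pochhammer a n / fact n \<le> max 1 a ^ (n + n)"
    by (rule order_trans[OF pochhammer_over_fact_le[OF assms]]) (intro power_increasing, auto)
  hence "sqrt (pochhammer a n / fact n) \<le> sqrt ((max 1 a ^ n)\<^sup>2)"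
    by (simp add: power_mult[symmetric] mult_2_right)
  thus ?thesis by simp
qed

text \<open>Turns the hypergeometric coefficients of the Meixner polynomial into binomial ones, for
  the degree as well as for the argument.\<close>

lemma pochhammer_minus_nat: "pochhammer (- real x) k = (-1) ^ k * (real (x choose k) * fact k)"
  using gbinomial_pochhammer[of "real x" k]
  by (simp add: binomial_gbinomial field_simps flip: power_mult_distrib)

text \<open>The k-th factorial moment of the negative binomial law is
  \<open>pochhammer \<beta> k * (c / (1 - c)) ^ k\<close>; dividing the falling factorial by it
  gives \<open>u k\<close>.\<close>

lemma centred_sequence_meixner:
  assumes b: "0 < \<beta>" and c: "0 < c" "c < 1"
  shows "centred_sequence (count_space UNIV) (neg_binomial_mass \<beta> c) (meixner \<beta> c) (2 * max 1 \<beta>)"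
proof (rule centred_sequenceI)
  define u where "u k x = real (x choose k) * fact k / pochhammer \<beta> k * (inverse c - 1) ^ k" for k x
  have P: "pochhammer \<beta> k > 0" for k using b by (rule pochhammer_pos)
  fix k
  show "has_bochner_integral (count_space UNIV) (\<lambda>x. neg_binomial_mass \<beta> c x * u k x) 1"
  proof (rule has_bochner_integral_count_space_nat)
    \<comment> \<open>Weighting by the k-th normalised falling factorial and shifting by
      \<open>k\<close> yields the negative binomial mass with parameter \<open>\<beta> + k\<close>,
      whose total is 1 by the binomial series at \<open>- c\<close>.\<close>
    let ?b = "\<beta> + real k"
    have eq: "neg_binomial_mass \<beta> c (x + k) * u k (x + k)
        = (1 - c) powr ?b * ((- ?b gchoose x) * (- c) ^ x)" for x
    proof -
      have "neg_binomial_mass \<beta> c (x + k) * u k (x + k)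
          = (1 - c) powr \<beta> * (c ^ k * (inverse c - 1) ^ k) * (c ^ x * (pochhammer \<beta> (k + x) / pochhammer \<beta> k) / fact x)"
        using P[of k] binomial_fact[of k "x + k", where 'a = real]
        by (simp add: neg_binomial_mass_def u_def power_add add.commute mult_ac)
      also have "pochhammer \<beta> (k + x) / pochhammer \<beta> k = pochhammer ?b x"
        using P[of k] by (simp add: pochhammer_product')
      also have "c ^ k * (inverse c - 1) ^ k = (1 - c) powr real k"
        using c by (simp add: powr_realpow right_diff_distrib flip: power_mult_distrib)
      also have "c ^ x * pochhammer ?b x / fact x = (- ?b gchoose x) * (- c) ^ x"
      proof -
        have "(- ?b gchoose x) * (- c) ^ x = ((-1) ^ x * (- c) ^ x) * pochhammer ?b x / fact x"
          using gbinomial_pochhammer[of "- ?b" x] by (simp add: add.commute)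
        thus ?thesis by (simp flip: power_mult_distrib)
      qed
      finally show ?thesis by (simp add: powr_add)
    qed
    have "(\<lambda>x. (1 - c) powr ?b * ((- ?b gchoose x) * (- c) ^ x)) sums ((1 - c) powr ?b * (1 + (- c)) powr (- ?b))"
      using c by (intro sums_mult gen_binomial_real) auto
    also have "(1 - c) powr ?b * (1 + (- c)) powr (- ?b) = 1"
      using c by (simp flip: powr_add)
    finally have "(\<lambda>x. neg_binomial_mass \<beta> c (x + k) * u k (x + k)) sums 1"
      unfolding eq .
    thus "(\<lambda>x. neg_binomial_mass \<beta> c x * u k x) sums 1"
      by (subst (asm) sums_iff_shift) (simp add: u_def binomial_eq_0)
  next
    fix x show "0 \<le> neg_binomial_mass \<beta> c x * u k x"
      using b c P[of k] P[of x] by (auto simp: neg_binomial_mass_def u_def less_imp_le one_le_inverse)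
  qed
  show "0 \<le> neg_binomial_mass \<beta> c x * u k x" for x
    using b c P[of k] P[of x] by (auto simp: neg_binomial_mass_def u_def less_imp_le one_le_inverse)
  fix n
  show "neg_binomial_mass \<beta> c x * meixner \<beta> c n x = sqrt (c ^ n * pochhammer \<beta> n / fact n) *
     (\<Sum>k\<le>n. (-1) ^ k * real (n choose k) * (neg_binomial_mass \<beta> c x * u k x))" for x
  proof -
    \<comment> \<open>The signs of the two rising factorials cancel. The alternating sign comes from
      \<open>1 - inverse c\<close>, which is negative, so that \<open>u k\<close> keeps the
      nonnegative base \<open>inverse c - 1\<close>.\<close>
    have "pochhammer (- real n) k * pochhammer (- real x) k / (pochhammer \<beta> k * fact k) * (1 - inverse c) ^ k
        = (-1) ^ k * real (n choose k) * u k x" for k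
    proof -
      have "(1 - inverse c) ^ k = (-1) ^ k * (inverse c - 1) ^ k"
        by (simp flip: power_mult_distrib)
      thus ?thesis by (simp add: pochhammer_minus_nat u_def mult_ac flip: power_mult_distrib)
    qed
    thus ?thesis by (simp add: meixner_def sum_distrib_left mult_ac)
  qed
  \<comment> \<open>Estimating \<open>c ^ n\<close> by 1 makes the growth rate depend on
    \<open>\<beta>\<close> alone.\<close>
  have "c ^ n * (pochhammer \<beta> n / fact n) \<le> 1 * (pochhammer \<beta> n / fact n)"
    using c P[of n] by (intro mult_right_mono power_le_one) auto
  hence "sqrt (c ^ n * pochhammer \<beta> n / fact n) \<le> sqrt (pochhammer \<beta> n / fact n)"
    by simp
  also have "\<dots> \<le> max 1 \<beta> ^ n" by (rule sqrt_pochhammer_over_fact_le[OF b])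
  finally show "\<bar>sqrt (c ^ n * pochhammer \<beta> n / fact n)\<bar> \<le> max 1 \<beta> ^ n"
    using c P[of n] by simp
qed auto

section \<open>Laguerre polynomials under the gamma weight\<close>

text \<open>The k-th moment is Euler's integral for \<open>Gamma (\<alpha> + k)\<close> divided by
  \<open>Gamma \<alpha>\<close>, which is \<open>pochhammer \<alpha> k\<close>.\<close>

lemma gamma_moment:
  assumes a: "0 < \<alpha>"
  shows "has_bochner_integral lborel (\<lambda>x. gamma_density \<alpha> x * (x ^ k / pochhammer \<alpha> k)) 1"
proof (rule has_bochner_integral_nn_integral)
  have P: "pochhammer \<alpha> k > 0" using a by (rule pochhammer_pos)
  have "\<alpha> \<notin> \<int>\<^sub>\<le>\<^sub>0"
    using a by (auto elim!: nonpos_Ints_cases)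
  moreover have "Gamma \<alpha> > 0" "Gamma (\<alpha> + real k) > 0"
    using a by (intro Gamma_real_pos; simp)+
  ultimately have G: "Gamma \<alpha> * pochhammer \<alpha> k = Gamma (\<alpha> + real k)" "Gamma \<alpha> > 0" "Gamma (\<alpha> + real k) > 0"
    by (simp_all add: pochhammer_Gamma)
  let ?g = "\<lambda>x. indicator {0..} x * x powr (\<alpha> + real k - 1) / exp x"
  have "(\<integral>\<^sup>+x. ennreal (gamma_density \<alpha> x * (x ^ k / pochhammer \<alpha> k)) \<partial>lborel)
      = (\<integral>\<^sup>+x. ennreal (inverse (Gamma (\<alpha> + real k))) * ennreal (?g x) \<partial>lborel)"
  proof (rule nn_integral_cong_AE)
    have "AE x in lborel. x \<noteq> (0::real)" by (rule AE_lborel_singleton)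
    thus "AE x in lborel. ennreal (gamma_density \<alpha> x * (x ^ k / pochhammer \<alpha> k))
        = ennreal (inverse (Gamma (\<alpha> + real k))) * ennreal (?g x)"
    proof eventually_elim
      case (elim x)
      show ?case
      proof (cases "x > 0")
        case True
        hence "x powr (\<alpha> + real k - 1) = x powr (\<alpha> - 1) * x ^ k"
          by (simp add: powr_realpow[symmetric] powr_add[symmetric] algebra_simps)
        with True show ?thesis
          using G by (simp add: gamma_density_def exp_minus field_simps flip: ennreal_mult' G(1))
      qed (use elim in \<open>auto simp: gamma_density_def\<close>)
    qed
  qed
  also have "\<dots> = ennreal (inverse (Gamma (\<alpha> + real k))) * ennreal (Gamma (\<alpha> + real k))"
    using a by (subst nn_integral_cmult) (auto simp: Gamma_conv_nn_integral_real)
  also have "\<dots> = ennreal 1"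
    using G by (simp flip: ennreal_mult')
  finally show "(\<integral>\<^sup>+x. ennreal (gamma_density \<alpha> x * (x ^ k / pochhammer \<alpha> k)) \<partial>lborel) = ennreal 1" .
  show "AE x in lborel. 0 \<le> gamma_density \<alpha> x * (x ^ k / pochhammer \<alpha> k)"
    using G P by (auto simp: gamma_density_def)
  show "(\<lambda>x. gamma_density \<alpha> x * (x ^ k / pochhammer \<alpha> k)) \<in> borel_measurable lborel"
    unfolding gamma_density_def by measurable
qed auto

text \<open>Extracts from the Laguerre coefficients the factor depending on \<open>n\<close> alone;
  what remains is an ordinary binomial coefficient over the k-th gamma moment, the form that
  \<open>centred_sequenceI\<close> expects.\<close>

lemma gbinomial_shifted_eq:
  assumes "0 < \<alpha>" "k \<le> n"
  shows "((real n + (\<alpha> - 1)) gchoose (n - k)) / fact k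
      = pochhammer \<alpha> n / fact n * (real (n choose k) / pochhammer \<alpha> k)"
proof -
  have P: "pochhammer \<alpha> k > 0" using assms by (intro pochhammer_pos)
  have "(real n + (\<alpha> - 1)) gchoose (n - k) = pochhammer (\<alpha> + real k) (n - k) / fact (n - k)"
    using assms by (simp add: gbinomial_pochhammer' of_nat_diff algebra_simps)
  also have "pochhammer (\<alpha> + real k) (n - k) = pochhammer \<alpha> n / pochhammer \<alpha> k"
    using assms P pochhammer_product[of k n \<alpha>] by simp
  finally show ?thesis
    using assms P by (simp add: binomial_fact field_simps)
qed

lemma centred_sequence_laguerre:
  assumes a: "0 < \<alpha>"
  shows "centred_sequence lborel (gamma_density \<alpha>)
    (\<lambda>n x. sqrt (fact n / pochhammer \<alpha> n) * laguerre (\<alpha> - 1) n x) (2 * max 1 \<alpha>)"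
proof (rule centred_sequenceI)
  have P: "pochhammer \<alpha> k > 0" for k using a by (rule pochhammer_pos)
  fix k show "has_bochner_integral lborel (\<lambda>x. gamma_density \<alpha> x * (x ^ k / pochhammer \<alpha> k)) 1"
    by (rule gamma_moment[OF a])
  show "0 \<le> gamma_density \<alpha> x * (x ^ k / pochhammer \<alpha> k)" for x
    using a P[of k] Gamma_real_pos[OF a] by (auto simp: gamma_density_def)
  fix n
  show "gamma_density \<alpha> x * (sqrt (fact n / pochhammer \<alpha> n) * laguerre (\<alpha> - 1) n x) =
     sqrt (pochhammer \<alpha> n / fact n) *
      (\<Sum>k\<le>n. (-1) ^ k * real (n choose k) * (gamma_density \<alpha> x * (x ^ k / pochhammer \<alpha> k)))" for x
  proof -
    have "laguerre (\<alpha> - 1) n x = pochhammer \<alpha> n / fact n *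
        (\<Sum>k\<le>n. (-1) ^ k * real (n choose k) * (x ^ k / pochhammer \<alpha> k))"
      unfolding laguerre_def sum_distrib_left
    proof (intro sum.cong refl)
      fix k assume "k \<in> {..n}"
      hence "((real n + (\<alpha> - 1)) gchoose (n - k)) / fact k
      = pochhammer \<alpha> n / fact n * (real (n choose k) / pochhammer \<alpha> k)"
        using a by (intro gbinomial_shifted_eq) auto
      hence "(-1) ^ k * x ^ k * (((real n + (\<alpha> - 1)) gchoose (n - k)) / fact k)
        = (-1) ^ k * x ^ k * (pochhammer \<alpha> n / fact n * (real (n choose k) / pochhammer \<alpha> k))"
        by (simp only:)
      thus "(real n + (\<alpha> - 1) gchoose (n - k)) * (- x) ^ k / fact k =
         pochhammer \<alpha> n / fact n * ((- 1) ^ k * real (n choose k) * (x ^ k / pochhammer \<alpha> k))"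
        by (simp add: power_minus[of x] mult_ac)
    qed
    \<comment> \<open>The orthonormalising factor is the inverse root of the extracted factor
      \<open>?y\<close>, so together they leave \<open>sqrt ?y\<close> as
      \<open>\<kappa> n\<close>.\<close>
    moreover have "sqrt (fact n / pochhammer \<alpha> n) * (pochhammer \<alpha> n / fact n) = sqrt (pochhammer \<alpha> n / fact n)"
    proof -
      let ?y = "pochhammer \<alpha> n / fact n"
      have "fact n / pochhammer \<alpha> n = inverse ?y" by simp
      hence "sqrt (fact n / pochhammer \<alpha> n) * ?y = ?y / sqrt ?y"
        by (simp only: real_sqrt_inverse divide_inverse[of ?y "sqrt ?y"] mult.commute)
      also have "\<dots> = sqrt ?y"
        using P[of n] by (intro real_div_sqrt) simp
      finally show ?thesis .
    qed
    ultimately have "sqrt (fact n / pochhammer \<alpha> n) * laguerre (\<alpha> - 1) n x = sqrt (pochhammer \<alpha> n / fact n) *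
        (\<Sum>k\<le>n. (-1) ^ k * real (n choose k) * (x ^ k / pochhammer \<alpha> k))"
      by (simp only: mult.assoc[symmetric])
    thus ?thesis by (simp add: sum_distrib_left mult_ac)
  qed
  show "\<bar>sqrt (pochhammer \<alpha> n / fact n)\<bar> \<le> max 1 \<alpha> ^ n"
    using sqrt_pochhammer_over_fact_le[OF a, of n] P[of n] by simp
qed auto

section \<open>Covariance bounds for the four Lancaster families\<close>

lemma sigma_finite_count_space_nat: "sigma_finite_measure (count_space (UNIV :: nat set))"
  by (rule sigma_finite_measure_count_space_countable) auto

text \<open>The coefficient \<open>fact n * Gamma \<alpha> / Gamma (\<alpha> + n)\<close> equals
  \<open>fact n / pochhammer \<alpha> n\<close>. Giving one square root of it to each Laguerre
  polynomial puts the density into the bilinear form of the general bound.\<close>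

lemma abs_covariance_lancaster_gamma:
  assumes M: "prob_space M" and X: "lancaster_gamma M \<alpha> \<rho> X Y"
    and ST: "S \<in> sets borel" "T \<in> sets borel"
  shows "\<bar>covariance M (\<lambda>\<omega>. of_bool (X \<omega> \<in> S)) (\<lambda>\<omega>. of_bool (Y \<omega> \<in> T))\<bar>
    \<le> 2 * ((2 * max 1 \<alpha>) * (2 * max 1 \<alpha>)) * \<rho>"
proof -
  let ?\<phi> = "\<lambda>n x. sqrt (fact n / pochhammer \<alpha> n) * laguerre (\<alpha> - 1) n x"
  from X have a: "0 < \<alpha>" and \<rho>: "0 \<le> \<rho>" by (auto simp: lancaster_gamma_def)
  have eq: "\<rho> ^ n * (fact n * Gamma \<alpha> / Gamma (\<alpha> + real n)) * laguerre (\<alpha> - 1) n x * laguerre (\<alpha> - 1) n y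
      = \<rho> ^ n * (?\<phi> n x * ?\<phi> n y)" for n x y
  proof -
    have "\<alpha> \<notin> \<int>\<^sub>\<le>\<^sub>0"
      using a by (auto elim!: nonpos_Ints_cases)
    hence "fact n * Gamma \<alpha> / Gamma (\<alpha> + real n) = fact n / pochhammer \<alpha> n"
      by (simp add: pochhammer_Gamma)
    also have "\<dots> = sqrt (fact n / pochhammer \<alpha> n) * sqrt (fact n / pochhammer \<alpha> n)"
      using pochhammer_pos[OF a, of n] by simp
    finally show ?thesis by (simp add: mult_ac)
  qed
  have id: "(\<lambda>(x, y). (x, y)) = (\<lambda>z :: real \<times> real. z)"
    by auto
  have "has_joint_density M X Y (lborel \<Otimes>\<^sub>M lborel) (\<lambda>(x, y). (x, y))
      (\<lambda>(x, y). gamma_density \<alpha> x * gamma_density \<alpha> y * (\<Sum>n. \<rho> ^ n * (?\<phi> n x * ?\<phi> n y)))"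
    using X unfolding lancaster_gamma_def eq id by (elim conjE)
  moreover have "(\<lambda>x. x) \<in> borel_measurable lborel"
    by measurable
  moreover have "0 \<le> 2 * max 1 \<alpha>"
    by simp
  ultimately show ?thesis
    using M ST \<rho> centred_sequence_laguerre[OF a] lborel.sigma_finite_measure_axioms
    by (intro abs_covariance_le_of_joint_density[where ?e1.0 = "\<lambda>x. x" and ?e2.0 = "\<lambda>x. x"])
qed

lemma abs_covariance_lancaster_poisson:
  assumes M: "prob_space M" and X: "lancaster_poisson M a \<rho> X Y"
    and ST: "S \<in> sets borel" "T \<in> sets borel"
  shows "\<bar>covariance M (\<lambda>\<omega>. of_bool (X \<omega> \<in> S)) (\<lambda>\<omega>. of_bool (Y \<omega> \<in> T))\<bar>
    \<le> 2 * ((2 * max 1 a) * (2 * max 1 a)) * \<rho>"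
proof -
  from X have a: "0 < a" and \<rho>: "0 \<le> \<rho>" by (auto simp: lancaster_poisson_def)
  have "has_joint_density M X Y (count_space UNIV \<Otimes>\<^sub>M count_space UNIV) (\<lambda>(x, y). (real x, real y))
      (\<lambda>(x, y). poisson_mass a x * poisson_mass a y * (\<Sum>n. \<rho> ^ n * (charlier a n x * charlier a n y)))"
    using X unfolding lancaster_poisson_def by (simp add: mult.assoc)
  from abs_covariance_le_of_joint_density[OF M _ _ centred_sequence_charlier[OF a] centred_sequence_charlier[OF a] _ _ \<rho> _ _ this ST]
  show ?thesis
    by (simp add: sigma_finite_count_space_nat)
qed

lemma abs_covariance_lancaster_neg_binomial:
  assumes M: "prob_space M" and X: "lancaster_neg_binomial M \<beta> c \<rho> X Y"
    and ST: "S \<in> sets borel" "T \<in> sets borel"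
  shows "\<bar>covariance M (\<lambda>\<omega>. of_bool (X \<omega> \<in> S)) (\<lambda>\<omega>. of_bool (Y \<omega> \<in> T))\<bar>
    \<le> 2 * ((2 * max 1 \<beta>) * (2 * max 1 \<beta>)) * \<rho>"
proof -
  from X have b: "0 < \<beta>" "0 < c" "c < 1" and \<rho>: "0 \<le> \<rho>"
    by (auto simp: lancaster_neg_binomial_def)
  have "has_joint_density M X Y (count_space UNIV \<Otimes>\<^sub>M count_space UNIV) (\<lambda>(x, y). (real x, real y))
      (\<lambda>(x, y). neg_binomial_mass \<beta> c x * neg_binomial_mass \<beta> c y *
        (\<Sum>n. \<rho> ^ n * (meixner \<beta> c n x * meixner \<beta> c n y)))"
    using X unfolding lancaster_neg_binomial_def by (simp add: mult.assoc)
  from abs_covariance_le_of_joint_density[OF M _ _ centred_sequence_meixner[OF b] centred_sequence_meixner[OF b] _ _ \<rho> _ _ this ST]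
  show ?thesis
    by (simp add: sigma_finite_count_space_nat)
qed

lemma abs_covariance_lancaster_gamma_neg_binomial:
  assumes M: "prob_space M" and X: "lancaster_gamma_neg_binomial M \<beta> c \<alpha> \<rho> X Y"
    and ST: "S \<in> sets borel" "T \<in> sets borel"
  shows "\<bar>covariance M (\<lambda>\<omega>. of_bool (X \<omega> \<in> S)) (\<lambda>\<omega>. of_bool (Y \<omega> \<in> T))\<bar>
    \<le> 2 * ((2 * max 1 \<beta>) * (2 * max 1 \<alpha>)) * \<rho>"
proof -
  let ?\<psi> = "\<lambda>n y. sqrt (fact n / pochhammer \<alpha> n) * laguerre (\<alpha> - 1) n y"
  from X have b: "0 < \<beta>" "0 < c" "c < 1" and a: "0 < \<alpha>" and \<rho>: "0 \<le> \<rho>"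
    by (auto simp: lancaster_gamma_neg_binomial_def)
  have eq: "\<rho> ^ n * sqrt (fact n / pochhammer \<alpha> n) * laguerre (\<alpha> - 1) n y * meixner \<beta> c n x
      = \<rho> ^ n * (meixner \<beta> c n x * ?\<psi> n y)" for n x y
    by (simp add: mult_ac)
  have "has_joint_density M X Y (count_space UNIV \<Otimes>\<^sub>M lborel) (\<lambda>(x, y). (real x, y))
      (\<lambda>(x, y). neg_binomial_mass \<beta> c x * gamma_density \<alpha> y *
        (\<Sum>n. \<rho> ^ n * (meixner \<beta> c n x * ?\<psi> n y)))"
    using X unfolding lancaster_gamma_neg_binomial_def eq by simp
  from abs_covariance_le_of_joint_density[OF M _ _ centred_sequence_meixner[OF b] centred_sequence_laguerre[OF a] _ _ \<rho> _ _ this ST]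
  show ?thesis
    by (simp add: sigma_finite_count_space_nat lborel.sigma_finite_measure_axioms)
qed

section \<open>Strong law for weakly correlated bounded variables\<close>

text \<open>For \<open>m\<close> between \<open>k ^ q\<close> and \<open>(k + 1) ^ q\<close> the
  partial sum differs from the one at \<open>k ^ q\<close> by at most the gap of the two powers, and
  the gap relative to \<open>k ^ q\<close> is \<open>(1 + 1 / k) ^ q - 1\<close>, which tends to
  0.\<close>

lemma averages_tendsto_0_of_power_subsequence:
  fixes y :: "nat \<Rightarrow> real"
  assumes y: "\<And>i. \<bar>y i\<bar> \<le> 1" and q: "0 < q"
    and sub: "(\<lambda>k. (\<Sum>i\<in>{1..k ^ q}. y i) / real (k ^ q)) \<longlonglongrightarrow> 0"
  shows "(\<lambda>m. (\<Sum>i\<in>{1..m}. y i) / real m) \<longlonglongrightarrow> 0"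
proof -
  define s where "s m = (\<Sum>i\<in>{1..m}. y i)" for m
  \<comment> \<open>The integer q-th root of \<open>m\<close>, rounded down. The maximum exists
    because \<open>0 < q\<close> gives \<open>k \<le> k ^ q\<close>, so all candidates are at most
    \<open>m\<close>.\<close>
  define \<kappa> where "\<kappa> m = (GREATEST k::nat. k ^ q \<le> m)" for m
  have le: "\<kappa> m ^ q \<le> m" and less: "m < Suc (\<kappa> m) ^ q" for m
  proof -
    have bound: "k \<le> m" if "k ^ q \<le> m" for k
      using that self_le_power[of k q] q by (cases "k = 0") auto
    show "\<kappa> m ^ q \<le> m"
      unfolding \<kappa>_def by (rule GreatestI_nat[of _ 0 m]) (use q bound in \<open>auto simp: power_0_left\<close>)
    show "m < Suc (\<kappa> m) ^ q"
    proof (rule ccontr)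
      assume "\<not> m < Suc (\<kappa> m) ^ q"
      hence "Suc (\<kappa> m) \<le> \<kappa> m"
        unfolding \<kappa>_def[of m] by (intro Greatest_le_nat[of _ _ m]) (use bound in auto)
      thus False by simp
    qed
  qed
  have \<kappa>: "filterlim \<kappa> at_top at_top"
    unfolding filterlim_at_top eventually_at_top_linorder
  proof (intro allI exI impI)
    fix B m assume "Suc B ^ q \<le> m"
    with less[of m] have "Suc B ^ q < Suc (\<kappa> m) ^ q" by linarith
    thus "B \<le> \<kappa> m" using power_less_imp_less_base[of "Suc B" q "Suc (\<kappa> m)"] by simp
  qed
  define b where "b k = \<bar>s (k ^ q) / real (k ^ q)\<bar> + ((1 + 1 / real k) ^ q - 1)" for k
  have "(\<lambda>k. (1 + 1 / real k) ^ q - 1) \<longlonglongrightarrow> (1 + 0) ^ q - 1"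
    by (intro tendsto_intros lim_1_over_n)
  hence "b \<longlonglongrightarrow> 0"
    unfolding b_def using tendsto_rabs_zero[OF sub] by (auto simp: s_def intro!: tendsto_add_zero)
  hence lim: "(\<lambda>m. b (\<kappa> m)) \<longlonglongrightarrow> 0"
    using \<kappa> by (rule filterlim_compose)
  have ev: "eventually (\<lambda>m. \<bar>s m / real m\<bar> \<le> b (\<kappa> m)) sequentially"
    using eventually_ge_at_top[of 1]
  proof eventually_elim
    case (elim m)
    have k: "0 < \<kappa> m" using less[of m] elim by (cases "\<kappa> m") auto
    define n where "n = \<kappa> m ^ q"
    have n: "0 < n" "n \<le> m" using k le[of m] by (auto simp: n_def)
    have "{1..m} = {1..n} \<union> {n<..m}" using n by auto
    hence "s m = s n + (\<Sum>i\<in>{n<..m}. y i)"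
      unfolding s_def by (simp add: sum.union_disjoint disjoint_iff)
    hence "\<bar>s m\<bar> \<le> \<bar>s n\<bar> + \<bar>\<Sum>i\<in>{n<..m}. y i\<bar>" by simp
    also have "\<bar>\<Sum>i\<in>{n<..m}. y i\<bar> \<le> (\<Sum>i\<in>{n<..m}. 1)"
      by (rule order_trans[OF sum_abs sum_mono]) (rule y)
    also have "\<dots> = real m - real n" using n by simp
    also have "\<dots> \<le> real (Suc (\<kappa> m)) ^ q - real n"
      using less_imp_le[OF less[of m]] by (metis diff_right_mono of_nat_le_iff of_nat_power)
    finally have sm: "\<bar>s m\<bar> \<le> \<bar>s n\<bar> + (real (Suc (\<kappa> m)) ^ q - real n)" by simp
    hence "\<bar>s m / real m\<bar> \<le> (\<bar>s n\<bar> + (real (Suc (\<kappa> m)) ^ q - real n)) / real m"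
      by (simp add: divide_right_mono)
    \<comment> \<open>Shrinking the denominator from \<open>m\<close> to \<open>n\<close> is
      legitimate because the numerator bounds an absolute value and is thus nonnegative;
      \<open>0 < n\<close> holds as \<open>1 \<le> m\<close>.\<close>
    also have "\<dots> \<le> (\<bar>s n\<bar> + (real (Suc (\<kappa> m)) ^ q - real n)) / real n"
      using n order_trans[OF abs_ge_zero sm] by (intro divide_left_mono) auto
    also have "\<dots> = \<bar>s n\<bar> / real n + (real (Suc (\<kappa> m)) ^ q / real n - 1)"
      using n by (simp add: add_divide_distrib diff_divide_distrib)
    also have "real (Suc (\<kappa> m)) ^ q / real n = (real (Suc (\<kappa> m)) / real (\<kappa> m)) ^ q"
      by (simp add: n_def power_divide)
    also have "real (Suc (\<kappa> m)) / real (\<kappa> m) = 1 + 1 / real (\<kappa> m)"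
      using k by (simp add: field_simps)
    finally show ?case by (simp add: b_def n_def)
  qed
  show ?thesis
    using Lim_null_comparison[OF ev[folded real_norm_def] lim] by (simp only: s_def)
qed

text \<open>Along a sparse subsequence the expected squared averages are summable, so the squared
  averages themselves are almost surely summable and tend to 0. Boundedness then fills the gaps of
  the subsequence.\<close>

lemma slln_of_second_moment_decay:
  fixes Y :: "nat \<Rightarrow> 'a \<Rightarrow> real"
  assumes M: "prob_space M"
    and Y: "\<And>i. Y i \<in> borel_measurable M" "\<And>i \<omega>. \<bar>Y i \<omega>\<bar> \<le> 1"
    and \<delta>: "0 < \<delta>"
    and decay: "eventually (\<lambda>m. (\<integral>\<omega>. ((\<Sum>i\<in>{1..m}. Y i \<omega>) / real m)\<^sup>2 \<partial>M) \<le> K * real m powr (- \<delta>)) sequentially"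
  shows "AE \<omega> in M. (\<lambda>m. (\<Sum>i\<in>{1..m}. Y i \<omega>) / real m) \<longlonglongrightarrow> 0"
proof -
  interpret prob_space M by fact
  note [measurable] = Y(1)
  \<comment> \<open>This choice gives \<open>2 < real q * \<delta>\<close>, so along
    \<open>k ^ q\<close> the second moments are eventually dominated by a multiple of
    \<open>1 / k ^ 2\<close>.\<close>
  obtain q :: nat where q: "2 / \<delta> < real q" using reals_Archimedean2 by blast
  with \<delta> have q0: "0 < q" by (cases q) auto
  define Z where "Z m \<omega> = ((\<Sum>i\<in>{1..m}. Y i \<omega>) / real m)\<^sup>2" for m \<omega>
  have Z_nonneg: "0 \<le> Z m \<omega>" for m \<omega>
    by (simp add: Z_def)
  have Z_le: "Z m \<omega> \<le> 1" for m \<omega>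
  proof -
    have "\<bar>\<Sum>i\<in>{1..m}. Y i \<omega>\<bar> \<le> (\<Sum>i\<in>{1..m}. 1)"
      by (rule order_trans[OF sum_abs sum_mono]) (rule Y)
    hence "\<bar>(\<Sum>i\<in>{1..m}. Y i \<omega>) / real m\<bar> \<le> 1" by (auto simp: divide_le_eq_1)
    thus ?thesis unfolding Z_def by (simp add: abs_square_le_1)
  qed
  have Z[measurable]: "Z m \<in> borel_measurable M" for m
    unfolding Z_def[abs_def] by measurable
  have Zi: "integrable M (Z m)" for m
    using Z_le by (intro integrable_const_bound[where B = 1]) (auto simp: abs_of_nonneg Z_nonneg)
  have pow: "filterlim (\<lambda>k::nat. k ^ q) at_top at_top"
  proof (rule filterlim_at_top_mono[OF filterlim_ident], intro always_eventually allI)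
    show "k \<le> k ^ q" for k :: nat
      using self_le_power[of k q] q0 by (cases "k = 0") auto
  qed
  have "eventually (\<lambda>k. (\<integral>\<omega>. Z (k ^ q) \<omega> \<partial>M) \<le> K * real (k ^ q) powr (- \<delta>)) sequentially"
    using filterlim_iff[THEN iffD1, OF pow, rule_format, OF decay] by (simp add: Z_def)
  hence "eventually (\<lambda>k. norm (\<integral>\<omega>. \<bar>Z (k ^ q) \<omega>\<bar> \<partial>M) \<le> \<bar>K\<bar> * inverse (real k ^ 2)) sequentially"
    using eventually_gt_at_top[of 0]
  proof eventually_elim
    case (elim k)
    have "norm (\<integral>\<omega>. \<bar>Z (k ^ q) \<omega>\<bar> \<partial>M) = (\<integral>\<omega>. Z (k ^ q) \<omega> \<partial>M)"
      by (simp add: Z_nonneg abs_of_nonneg)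
    also note elim(1)
    also have "K * real (k ^ q) powr (- \<delta>) \<le> \<bar>K\<bar> * real (k ^ q) powr (- \<delta>)"
      by (intro mult_right_mono) auto
    also have "real (k ^ q) powr (- \<delta>) = real k powr (- (real q * \<delta>))"
      using elim(2) by (simp add: powr_powr flip: powr_realpow)
    also have "\<dots> \<le> real k powr (- 2)"
      using q \<delta> elim(2) by (intro powr_mono) (auto simp: field_simps)
    also have "\<dots> = inverse (real k ^ 2)"
      using elim(2) by (simp add: powr_minus)
    finally show ?case by (simp add: mult_left_mono)
  qed
  hence "summable (\<lambda>k. \<integral>\<omega>. \<bar>Z (k ^ q) \<omega>\<bar> \<partial>M)"
    by (rule summable_comparison_test_ev)
      (intro summable_mult inverse_power_summable order_refl)
  hence "AE \<omega> in M. summable (\<lambda>k. \<bar>Z (k ^ q) \<omega>\<bar>)"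
    by (intro AE_summable_of_summable_integral Zi)
  thus ?thesis
  proof eventually_elim
    case (elim \<omega>)
    have "(\<lambda>k. sqrt \<bar>Z (k ^ q) \<omega>\<bar>) \<longlonglongrightarrow> sqrt 0"
      by (intro tendsto_real_sqrt summable_LIMSEQ_zero elim)
    hence "(\<lambda>k. (\<Sum>i\<in>{1..k ^ q}. Y i \<omega>) / real (k ^ q)) \<longlonglongrightarrow> 0"
      by (simp add: Z_def tendsto_rabs_zero_iff flip: abs_divide)
    thus ?case
      by (intro averages_tendsto_0_of_power_subsequence[OF Y(2) q0])
  qed
qed

text \<open>Expanding the square of the average, the diagonal contributes at most \<open>m\<close>
  and the rest at most \<open>C\<close> times the entrywise norm, so the second moment decays like a
  power of \<open>m\<close>. The weights \<open>w\<close> treat all hypotheses and the true nulls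
  alike.\<close>

lemma slln_of_small_covariances:
  fixes X :: "nat \<Rightarrow> 'a \<Rightarrow> real" and w :: "nat \<Rightarrow> real"
  assumes M: "prob_space M"
    and X: "\<And>i. 1 \<le> i \<Longrightarrow> X i \<in> borel_measurable M" "\<And>i \<omega>. 0 \<le> X i \<omega>" "\<And>i \<omega>. X i \<omega> \<le> 1"
    and w: "\<And>i. \<bar>w i\<bar> \<le> 1" and C: "0 \<le> C"
    and cov: "\<And>i j. 1 \<le> i \<Longrightarrow> 1 \<le> j \<Longrightarrow> i \<noteq> j \<Longrightarrow> \<bar>covariance M (X i) (X j)\<bar> \<le> C * \<bar>\<rho> i j\<bar>"
    and \<delta>: "0 < \<delta>"
    and norm: "(\<lambda>m. entrywise_norm1 \<rho> m / (real m)\<^sup>2) \<in> O(\<lambda>m. real m powr (- \<delta>))"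
  shows "AE \<omega> in M. (\<lambda>m. (\<Sum>i\<in>{1..m}. w i * (X i \<omega> - (\<integral>\<omega>'. X i \<omega>' \<partial>M))) / real m) \<longlonglongrightarrow> 0"
proof -
  interpret prob_space M by fact
  have int: "integrable M (X i)" if "1 \<le> i" for i
    using X that by (intro integrable_const_bound[where B = 1]) auto
  \<comment> \<open>The assumptions on \<open>X\<close> concern indices from 1 on, whereas the
    preceding limit lemma asks for all indices; the value 0 at index 0 closes the gap without
    entering any sum.\<close>
  define Y where "Y i \<omega> = (if i = 0 then 0 else w i * (X i \<omega> - expectation (X i)))" for i \<omega>
  have Y: "Y i \<in> borel_measurable M" for i
    using X(1)[of i] unfolding Y_def by (cases "i = 0") auto
  have Y_le: "\<bar>Y i \<omega>\<bar> \<le> 1" for i \<omega>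
  proof (cases "i = 0")
    case False
    have "0 \<le> expectation (X i)" "expectation (X i) \<le> 1"
      using int[of i] X False by (auto intro!: integral_nonneg_AE integral_le_const)
    hence "\<bar>X i \<omega> - expectation (X i)\<bar> \<le> 1"
      using X(2,3)[of i \<omega>] by (simp add: abs_le_iff)
    hence "\<bar>w i\<bar> * \<bar>X i \<omega> - expectation (X i)\<bar> \<le> 1"
      using w[of i] by (intro mult_le_one) auto
    thus ?thesis using False by (simp add: Y_def abs_mult)
  qed (simp add: Y_def)
  have YY_le: "\<bar>Y i \<omega> * Y j \<omega>\<bar> \<le> 1" for i j \<omega>
    unfolding abs_mult using Y_le by (intro mult_le_one) auto
  have YY_int: "integrable M (\<lambda>\<omega>. Y i \<omega> * Y j \<omega>)" for i j
    using Y YY_le by (intro integrable_const_bound[where B = 1]) auto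
  \<comment> \<open>Adding the nonnegative \<open>C * \<bar>\<rho> i j\<bar>\<close> on the diagonal
    too makes the double sum exactly \<open>m + C * entrywise_norm1 \<rho> m\<close>.\<close>
  have YY: "expectation (\<lambda>\<omega>. Y i \<omega> * Y j \<omega>) \<le> of_bool (i = j) + C * \<bar>\<rho> i j\<bar>" if ij: "1 \<le> i" "1 \<le> j" for i j
  proof (cases "i = j")
    case True
    have "expectation (\<lambda>\<omega>. Y i \<omega> * Y j \<omega>) \<le> 1"
      using YY_int YY_le by (intro integral_le_const) (auto simp: abs_le_iff)
    with True C show ?thesis by (simp add: add_increasing2)
  next
    case False
    have "expectation (\<lambda>\<omega>. Y i \<omega> * Y j \<omega>) = expectation (\<lambda>\<omega>. (w i * w j) * ((X i \<omega> - expectation (X i)) * (X j \<omega> - expectation (X j))))"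
      using ij by (simp add: Y_def mult_ac)
    also have "\<dots> = (w i * w j) * covariance M (X i) (X j)"
      by (simp add: covariance_def)
    also have "\<dots> \<le> \<bar>w i * w j\<bar> * \<bar>covariance M (X i) (X j)\<bar>"
      by (metis abs_ge_self abs_mult)
    also have "\<dots> \<le> 1 * (C * \<bar>\<rho> i j\<bar>)"
      unfolding abs_mult[of "w i"] using w[of i] w[of j] ij False
      by (intro mult_mono cov mult_le_one) auto
    finally show ?thesis using False by simp
  qed
  obtain c where c: "0 < c" and bound: "eventually (\<lambda>m. norm (entrywise_norm1 \<rho> m / (real m)\<^sup>2) \<le> c * norm (real m powr (- \<delta>))) sequentially"
    using norm by (elim landau_o.bigE)
  \<comment> \<open>The diagonal bound contributes \<open>1 / m\<close> however fast the norm
    decays, so the rate guaranteed here is capped at 1.\<close>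
  define d where "d = min \<delta> 1"
  have "eventually (\<lambda>m. expectation (\<lambda>\<omega>. ((\<Sum>i\<in>{1..m}. Y i \<omega>) / real m)\<^sup>2) \<le> (1 + C * c) * real m powr (- d)) sequentially"
    using bound eventually_gt_at_top[of 0]
  proof eventually_elim
    case (elim m)
    have "expectation (\<lambda>\<omega>. ((\<Sum>i\<in>{1..m}. Y i \<omega>) / real m)\<^sup>2)
        = expectation (\<lambda>\<omega>. (\<Sum>i\<in>{1..m}. \<Sum>j\<in>{1..m}. Y i \<omega> * Y j \<omega>) / (real m)\<^sup>2)"
      by (simp add: power2_eq_square sum_product)
    also have "\<dots> = (\<Sum>i\<in>{1..m}. \<Sum>j\<in>{1..m}. expectation (\<lambda>\<omega>. Y i \<omega> * Y j \<omega>)) / (real m)\<^sup>2"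
      using YY_int by simp
    also have "\<dots> \<le> (\<Sum>i\<in>{1..m}. \<Sum>j\<in>{1..m}. of_bool (i = j) + C * \<bar>\<rho> i j\<bar>) / (real m)\<^sup>2"
      using YY by (intro divide_right_mono sum_mono) auto
    also have "(\<Sum>i\<in>{1..m}. \<Sum>j\<in>{1..m}. of_bool (i = j) + C * \<bar>\<rho> i j\<bar>) = real m + C * entrywise_norm1 \<rho> m"
    proof -
      have "(\<Sum>i\<in>{1..m}. \<Sum>j\<in>{1..m}. of_bool (i = j) :: real) = (\<Sum>i\<in>{1..m}. 1)"
        by (intro sum.cong refl) (simp add: of_bool_def)
      thus ?thesis by (simp add: sum.distrib entrywise_norm1_def sum_distrib_left)
    qed
    also have "(real m + C * entrywise_norm1 \<rho> m) / (real m)\<^sup>2 = real m powr (- 1) + C * (entrywise_norm1 \<rho> m / (real m)\<^sup>2)"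
      using elim(2) by (simp add: powr_minus_divide field_simps power2_eq_square)
    also have "\<dots> \<le> real m powr (- 1) + C * (c * real m powr (- \<delta>))"
      using order_trans[OF abs_ge_self elim(1)[unfolded real_norm_def]] C
      by (intro add_left_mono mult_left_mono) auto
    also have "\<dots> \<le> real m powr (- d) + C * (c * real m powr (- d))"
      using elim(2) C c by (intro add_mono mult_left_mono powr_mono) (auto simp: d_def)
    finally show ?case by (simp add: algebra_simps)
  qed
  hence "AE \<omega> in M. (\<lambda>m. (\<Sum>i\<in>{1..m}. Y i \<omega>) / real m) \<longlonglongrightarrow> 0"
    by (intro slln_of_second_moment_decay[OF M Y Y_le]) (use \<delta> in \<open>auto simp: d_def\<close>)
  moreover have "(\<Sum>i\<in>{1..m}. Y i \<omega>) = (\<Sum>i\<in>{1..m}. w i * (X i \<omega> - expectation (X i)))" for m \<omega>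
    by (intro sum.cong) (auto simp: Y_def)
  ultimately show ?thesis by simp
qed

section \<open>Rejection regions and the limit statements for \<open>R\<close> and
  \<open>V\<close>\<close>

lemma cdf_superlevel_borel:
  assumes "real_distribution N"
  shows "{x. a \<le> cdf N x} \<in> sets borel"
proof -
  interpret real_distribution N by fact
  have "mono (cdf N)"
    by (intro monoI cdf_nondecreasing)
  hence [measurable]: "cdf N \<in> borel_measurable borel"
    by (rule borel_measurable_mono)
  show ?thesis by measurable
qed

theorem theorem1:
  fixes M :: "'a measure"
    and \<zeta> :: "nat \<Rightarrow> 'a \<Rightarrow> real"
    and \<Theta> :: "real set" and \<mu> :: "nat \<Rightarrow> real" and \<mu>0 t :: real
    and L :: "nat \<Rightarrow> real \<Rightarrow> real measure"
    and \<rho> :: "nat \<Rightarrow> nat \<Rightarrow> real"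
    and p :: "nat \<Rightarrow> 'a \<Rightarrow> real"
    and m0 :: "nat \<Rightarrow> nat"
    and R V :: "nat \<Rightarrow> 'a \<Rightarrow> real"
    and \<alpha>1 \<alpha>2 \<beta>3 c3 \<beta>4 c4 \<alpha>4 :: real
  assumes prob: "prob_space M"
    and rv: "\<And>i. 1 \<le> i \<Longrightarrow> \<zeta> i \<in> borel_measurable M"
    and param: "\<And>i. 1 \<le> i \<Longrightarrow> \<mu> i \<in> \<Theta>" and null_param: "\<mu>0 \<in> \<Theta>"
    and family: "\<And>i \<theta>. 1 \<le> i \<Longrightarrow> \<theta> \<in> \<Theta> \<Longrightarrow> real_distribution (L i \<theta>)"
    and actual_law: "\<And>i. 1 \<le> i \<Longrightarrow> distr M borel (\<zeta> i) = L i (\<mu> i)"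
    and t: "0 \<le> t" "t \<le> 1"
    and p_eq: "p = p_value L \<mu>0 \<zeta>"
    and m0_eq: "m0 = (\<lambda>m. card (true_nulls \<mu> \<mu>0 m))"
    and R_eq: "R = num_rejections p t"
    and V_eq: "V = num_false_rejections \<mu> \<mu>0 p t"
    and rho_eq: "\<rho> = (\<lambda>i j. correlation M (\<zeta> i) (\<zeta> j))"
    and par1: "0 < \<alpha>1" "\<alpha>1 \<le> 1"
    and par2: "0 < \<alpha>2"
    and par3: "0 < \<beta>3" "0 < c3" "c3 < 1"
    and par4: "0 < \<beta>4" "0 < c4" "c4 < 1" "0 < \<alpha>4"
    and lancaster: "\<And>i j. 1 \<le> i \<Longrightarrow> 1 \<le> j \<Longrightarrow> i \<noteq> j \<Longrightarrow>
          lancaster_gamma M \<alpha>1 (\<rho> i j) (\<zeta> i) (\<zeta> j)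
        \<or> lancaster_poisson M \<alpha>2 (\<rho> i j) (\<zeta> i) (\<zeta> j)
        \<or> lancaster_neg_binomial M \<beta>3 c3 (\<rho> i j) (\<zeta> i) (\<zeta> j)
        \<or> lancaster_gamma_neg_binomial M \<beta>4 c4 \<alpha>4 (\<rho> i j) (\<zeta> i) (\<zeta> j)
        \<or> lancaster_gamma_neg_binomial M \<beta>4 c4 \<alpha>4 (\<rho> i j) (\<zeta> j) (\<zeta> i)"
  shows "(\<exists>C>0. \<forall>i\<ge>1. \<forall>j\<ge>1. i \<noteq> j \<longrightarrow>
            \<bar>covariance M (rejected p t i) (rejected p t j)\<bar> \<le> C * \<bar>\<rho> i j\<bar>)
    \<and> ((\<exists>\<delta>>0. (\<lambda>m. entrywise_norm1 \<rho> m / (real m)\<^sup>2) \<in> O(\<lambda>m. real m powr (- \<delta>)))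
         \<longrightarrow> (AE \<omega> in M. (\<lambda>m. \<bar>R m \<omega> / real m - (\<integral>\<omega>'. R m \<omega>' / real m \<partial>M)\<bar>) \<longlonglongrightarrow> 0)
           \<and> (AE \<omega> in M. (\<lambda>m. \<bar>V m \<omega> / real m - (\<integral>\<omega>'. V m \<omega>' / real m \<partial>M)\<bar>) \<longlonglongrightarrow> 0))
    \<and> ((\<exists>\<delta>>0. (\<lambda>m. entrywise_norm1 \<rho> m / (real m)\<^sup>2) \<in> O(\<lambda>m. real m powr (- \<delta>)))
         \<and> 0 < liminf (\<lambda>m. ereal (real (m0 m) / real m))
         \<longrightarrow> (AE \<omega> in M. (\<lambda>m. \<bar>V m \<omega> / real (m0 m) - (\<integral>\<omega>'. V m \<omega>' / real (m0 m) \<partial>M)\<bar>) \<longlonglongrightarrow> 0))"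
proof -
  interpret prob_space M by (rule prob)
  define X where "X = rejected p t"
  \<comment> \<open>The rejection region of test \<open>i\<close>:
    \<open>p i \<omega> \<le> t\<close> means that \<open>\<zeta> i \<omega>\<close> lies in it,
    which brings the covariances under the bounds for arbitrary Borel sets.\<close>
  define S where "S i = {x. 1 - cdf (L i \<mu>0) x \<le> t}" for i
  have S: "S i \<in> sets borel" if "1 \<le> i" for i
    unfolding S_def using cdf_superlevel_borel[OF family[OF that null_param], of "1 - t"]
    by (simp add: algebra_simps)
  have X_eq: "X i = (\<lambda>\<omega>. of_bool (\<zeta> i \<omega> \<in> S i))" for i
    by (auto simp: X_def rejected_def p_eq p_value_def S_def)
  have X_meas: "X i \<in> borel_measurable M" if "1 \<le> i" for i
  proof -
    note [measurable] = rv[OF that] S[OF that]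
    show ?thesis unfolding X_eq by measurable
  qed
  have X_bounds: "0 \<le> X i \<omega>" "X i \<omega> \<le> 1" for i \<omega>
    by (simp_all add: X_eq)
  have X_int: "integrable M (X i)" if "1 \<le> i" for i
    using X_meas[OF that] X_bounds by (intro integrable_const_bound[where B = 1]) auto

  \<comment> \<open>\<open>B\<close> dominates 1 and every parameter that enters a growth rate, so
    the single constant \<open>C\<close> covers all families and all pairs.\<close>
  define B where "B = max (max 1 \<alpha>1) (max \<alpha>2 (max \<beta>3 (max \<beta>4 \<alpha>4)))"
  define C where "C = 2 * ((2 * B) * (2 * B))"
  have B: "1 \<le> B" by (simp add: B_def)
  hence C: "0 < C" by (simp add: C_def)
  have C_ge: "2 * ((2 * max 1 a) * (2 * max 1 b)) * r \<le> C * \<bar>r\<bar>"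
    if "a \<le> B" "b \<le> B" for a b r
  proof -
    have "2 * ((2 * max 1 a) * (2 * max 1 b)) * r \<le> 2 * ((2 * max 1 a) * (2 * max 1 b)) * \<bar>r\<bar>"
      by (intro mult_left_mono) auto
    also have "\<dots> \<le> C * \<bar>r\<bar>"
      unfolding C_def using that B by (intro mult_right_mono mult_left_mono mult_mono) auto
    finally show ?thesis .
  qed
  have cov: "\<bar>covariance M (X i) (X j)\<bar> \<le> C * \<bar>\<rho> i j\<bar>" if ij: "1 \<le> i" "1 \<le> j" "i \<noteq> j" for i j
  proof -
    note Sij = S[OF ij(1)] S[OF ij(2)]
    have le_B: "\<alpha>1 \<le> B" "\<alpha>2 \<le> B" "\<beta>3 \<le> B" "\<beta>4 \<le> B" "\<alpha>4 \<le> B"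
      by (auto simp: B_def)
    from lancaster[OF ij] show ?thesis
    proof (elim disjE)
      assume "lancaster_gamma M \<alpha>1 (\<rho> i j) (\<zeta> i) (\<zeta> j)"
      from abs_covariance_lancaster_gamma[OF prob this Sij] show ?thesis
        unfolding X_eq by (rule order_trans) (intro C_ge le_B)
    next
      assume "lancaster_poisson M \<alpha>2 (\<rho> i j) (\<zeta> i) (\<zeta> j)"
      from abs_covariance_lancaster_poisson[OF prob this Sij] show ?thesis
        unfolding X_eq by (rule order_trans) (intro C_ge le_B)
    next
      assume "lancaster_neg_binomial M \<beta>3 c3 (\<rho> i j) (\<zeta> i) (\<zeta> j)"
      from abs_covariance_lancaster_neg_binomial[OF prob this Sij] show ?thesis
        unfolding X_eq by (rule order_trans) (intro C_ge le_B)
    next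
      assume "lancaster_gamma_neg_binomial M \<beta>4 c4 \<alpha>4 (\<rho> i j) (\<zeta> i) (\<zeta> j)"
      from abs_covariance_lancaster_gamma_neg_binomial[OF prob this Sij] show ?thesis
        unfolding X_eq by (rule order_trans) (intro C_ge le_B)
    next
      \<comment> \<open>The reversed orientation of the mixed pair: the bound is applied with the
        two regions swapped and carried back by symmetry of the covariance.\<close>
      assume "lancaster_gamma_neg_binomial M \<beta>4 c4 \<alpha>4 (\<rho> i j) (\<zeta> j) (\<zeta> i)"
      from abs_covariance_lancaster_gamma_neg_binomial[OF prob this Sij(2,1)] show ?thesis
        unfolding X_eq covariance_commute[of M "\<lambda>\<omega>. of_bool (\<zeta> i \<omega> \<in> S i)"]
        by (rule order_trans) (intro C_ge le_B)
    qed
  qed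

  \<comment> \<open>A common form of both counts: constant weight 1 gives \<open>R\<close>, and the
    indicator of the true nulls gives \<open>V\<close>.\<close>
  define W where "W w m \<omega> = (\<Sum>i\<in>{1..m}. w i * X i \<omega>)" for w :: "nat \<Rightarrow> real" and m \<omega>
  have slln: "AE \<omega> in M. (\<lambda>m. \<bar>W w m \<omega> / real m - expectation (\<lambda>\<omega>'. W w m \<omega>' / real m)\<bar>) \<longlonglongrightarrow> 0"
    if w: "\<And>i. \<bar>w i\<bar> \<le> 1" and \<delta>: "0 < \<delta>"
      and norm: "(\<lambda>m. entrywise_norm1 \<rho> m / (real m)\<^sup>2) \<in> O(\<lambda>m. real m powr (- \<delta>))" for w \<delta>
  proof -
    have eq: "W w m \<omega> / real m - expectation (\<lambda>\<omega>'. W w m \<omega>' / real m)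
        = (\<Sum>i\<in>{1..m}. w i * (X i \<omega> - expectation (X i))) / real m" for m \<omega>
      using X_int by (simp add: W_def right_diff_distrib sum_subtractf diff_divide_distrib)
    show ?thesis
      unfolding eq tendsto_rabs_zero_iff
      by (rule slln_of_small_covariances[OF prob X_meas X_bounds w less_imp_le[OF C] cov \<delta> norm])
  qed
  have R_W: "R = W (\<lambda>_. 1)"
    by (simp add: fun_eq_iff R_eq num_rejections_def W_def X_def)
  have V_W: "V = W (\<lambda>i. of_bool (\<mu> i = \<mu>0))"
  proof (intro ext)
    fix m \<omega>
    have "true_nulls \<mu> \<mu>0 m = {1..m} \<inter> {i. \<mu> i = \<mu>0}"
      by (auto simp: true_nulls_def)
    thus "V m \<omega> = W (\<lambda>i. of_bool (\<mu> i = \<mu>0)) m \<omega>"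
      by (simp add: V_eq num_false_rejections_def W_def X_def sum.inter_restrict of_bool_def if_distrib[of "\<lambda>x. x * _"] cong: if_cong)
  qed
  \<comment> \<open>Since \<open>m0 m\<close> is deterministic, replacing the divisor
    \<open>m\<close> by \<open>m0 m\<close> multiplies the centred average by
    \<open>m / m0 m\<close>, which the lower limit keeps bounded.\<close>
  have scale: "AE \<omega> in M. (\<lambda>m. \<bar>V m \<omega> / real (m0 m) - expectation (\<lambda>\<omega>'. V m \<omega>' / real (m0 m))\<bar>) \<longlonglongrightarrow> 0"
    if V: "AE \<omega> in M. (\<lambda>m. \<bar>V m \<omega> / real m - expectation (\<lambda>\<omega>'. V m \<omega>' / real m)\<bar>) \<longlonglongrightarrow> 0"
      and liminf: "0 < liminf (\<lambda>m. ereal (real (m0 m) / real m))"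
  proof -
    \<comment> \<open>With a real \<open>e\<close> strictly between 0 and the lower limit,
      eventually \<open>m0 m / m > e\<close>. This bounds the factor by \<open>inverse e\<close> and
      makes both divisors nonzero.\<close>
    from ereal_dense2[OF liminf] obtain e where e: "0 < e" "ereal e < liminf (\<lambda>m. ereal (real (m0 m) / real m))"
      by auto
    have ev: "eventually (\<lambda>m. e < real (m0 m) / real m) sequentially"
      using less_LiminfD[OF e(2)] by simp
    from V show ?thesis
    proof eventually_elim
      case (elim \<omega>)
      let ?d = "\<lambda>m. \<bar>V m \<omega> / real m - expectation (\<lambda>\<omega>'. V m \<omega>' / real m)\<bar>"
      have le: "eventually (\<lambda>m. norm (V m \<omega> / real (m0 m) - expectation (\<lambda>\<omega>'. V m \<omega>' / real (m0 m))) \<le> inverse e * ?d m) sequentially"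
        using ev
      proof eventually_elim
        case (elim m)
        with e have pos: "0 < real (m0 m) / real m" by linarith
        hence m: "0 < real m" "0 < real (m0 m)"
          by (auto simp: zero_less_divide_iff)
        have "V m \<omega> / real (m0 m) - expectation (\<lambda>\<omega>'. V m \<omega>' / real (m0 m))
            = inverse (real (m0 m) / real m) * (V m \<omega> / real m - expectation (\<lambda>\<omega>'. V m \<omega>' / real m))"
          using m by (simp add: field_simps)
        hence "norm (V m \<omega> / real (m0 m) - expectation (\<lambda>\<omega>'. V m \<omega>' / real (m0 m)))
            = inverse (real (m0 m) / real m) * ?d m"
          using pos by (simp add: abs_mult)
        also have "\<dots> \<le> inverse e * ?d m"
          using elim e by (intro mult_right_mono le_imp_inverse_le) auto
        finally show ?case .
      qed
      show ?case
        by (rule tendsto_rabs_zero[OF Lim_null_comparison[OF le tendsto_mult_right_zero[OF elim]]])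
    qed
  qed
  let ?decay = "\<exists>\<delta>>0. (\<lambda>m. entrywise_norm1 \<rho> m / (real m)\<^sup>2) \<in> O(\<lambda>m. real m powr (- \<delta>))"
  have R_slln: "AE \<omega> in M. (\<lambda>m. \<bar>R m \<omega> / real m - expectation (\<lambda>\<omega>'. R m \<omega>' / real m)\<bar>) \<longlonglongrightarrow> 0"
    and V_slln: "AE \<omega> in M. (\<lambda>m. \<bar>V m \<omega> / real m - expectation (\<lambda>\<omega>'. V m \<omega>' / real m)\<bar>) \<longlonglongrightarrow> 0"
    if decay: ?decay
  proof -
    from decay obtain \<delta> where \<delta>: "0 < \<delta>"
      "(\<lambda>m. entrywise_norm1 \<rho> m / (real m)\<^sup>2) \<in> O(\<lambda>m. real m powr (- \<delta>))"
      by blast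
    show "AE \<omega> in M. (\<lambda>m. \<bar>R m \<omega> / real m - expectation (\<lambda>\<omega>'. R m \<omega>' / real m)\<bar>) \<longlonglongrightarrow> 0"
      unfolding R_W by (rule slln[OF _ \<delta>]) simp
    show "AE \<omega> in M. (\<lambda>m. \<bar>V m \<omega> / real m - expectation (\<lambda>\<omega>'. V m \<omega>' / real m)\<bar>) \<longlonglongrightarrow> 0"
      unfolding V_W by (rule slln[OF _ \<delta>]) simp
  qed
  have "\<exists>C>0. \<forall>i\<ge>1. \<forall>j\<ge>1. i \<noteq> j \<longrightarrow> \<bar>covariance M (X i) (X j)\<bar> \<le> C * \<bar>\<rho> i j\<bar>"
    using C cov by blast
  thus ?thesis
    unfolding X_def
  proof (intro conjI impI)
    assume ?decay
    thus "AE \<omega> in M. (\<lambda>m. \<bar>R m \<omega> / real m - expectation (\<lambda>\<omega>'. R m \<omega>' / real m)\<bar>) \<longlonglongrightarrow> 0"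
      "AE \<omega> in M. (\<lambda>m. \<bar>V m \<omega> / real m - expectation (\<lambda>\<omega>'. V m \<omega>' / real m)\<bar>) \<longlonglongrightarrow> 0"
      by (rule R_slln, rule V_slln)
  next
    assume "?decay \<and> 0 < liminf (\<lambda>m. ereal (real (m0 m) / real m))"
    thus "AE \<omega> in M. (\<lambda>m. \<bar>V m \<omega> / real (m0 m) - expectation (\<lambda>\<omega>'. V m \<omega>' / real (m0 m))\<bar>) \<longlonglongrightarrow> 0"
      by (elim conjE) (rule scale[OF V_slln])
  qed
qed

end
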